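(* Let $b>0$ and $\alpha>0$. Suppose $X=\{x_k\}_{k\in\mathbb{Z}}\subset\mathbb{R}$ is separated and has a sine-type generating function $S$ with $\mathrm{type}(S)\le\pi b$, and let $\tilde{x}\in\mathbb{R}$ with $\tilde{x}\notin X$. Suppose also that $\tilde{A}=\{a_k\}_{k\in\mathbb{Z}}\cup\{\tilde{a}\}$ is a collection of i.i.d. random variables uniformly distributed in $[-\alpha,\alpha]$. Let $f$ be the bandlimited interpolation of $\tilde{A}$ at $\tilde{X}=X\cup\{\tilde{x}\}$. Then almost surely $$\sup_{r>0}\frac{1}{2r}\int_{-r}^{r}|f(t)|\,dt<\infty.$$
   Context: The type of an entire function $f$ is $\mathrm{type}(f)=\inf\{\beta: \text{there is } C \text{ with } |f(z)|\le Ce^{\beta|z|}\text{ for all }z\in\mathbb{C}\}$ (with $\mathrm{type}(f)=\infty$ if no such $\beta$ exists). Sequences $X=\{x_k\}_{k\in\mathbb{Z}}\subset\mathbb{R}$ are indexed so that $x_k<x_{k+1}$. $X$ is separated if $\inf_k|x_{k+1}-x_k|>0$. The generating function of $X$ is $$S(z)=z^{\delta_X}\lim_{r\to\infty}\prod_{0<|x_k|<r}\left(1-\frac{z}{x_k}\right),$$ where $\delta_X=1$ if $0\in X$ and $\delta_X=0$ otherwise. For real and separated $X$, $S$ is called sine-type if: (I) the product converges and $\mathrm{type}(S)=\pi\beta<\infty$ for some $\beta$; (II) for any $\epsilon>0$ there are positive constants $C_1(\epsilon),C_2(\epsilon)$ such that $C_1(\epsilon)\le e^{-\pi\beta|\mathrm{Im}(z)|}|S(z)|\le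 C_2(\epsilon)$ whenever $\mathrm{dist}(z,X)>\epsilon$ (with the same $\beta$ as in (I)). For a bounded collection $\tilde{A}=\{a_k\}_{k\in\mathbb{Z}}\cup\{\tilde{a}\}$, the bandlimited interpolation of $\tilde{A}$ at $\tilde{X}=X\cup\{\tilde{x}\}$ is the entire function $$f(z)=\tilde{a}\frac{S(z)}{S(\tilde{x})}+\sum_{k=-\infty}^{\infty}a_k\lim_{z_0\to z}\frac{S(z_0)}{S'(x_k)}\left(\frac{1}{z_0-x_k}-\frac{1}{\tilde{x}-x_k}\right),$$ the series converging uniformly on compact subsets of $\mathbb{C}$; it satisfies $f(x_k)=a_k$ and $f(\tilde{x})=\tilde{a}$. *)

theory Defs
  imports "HOL-Probability.Probability" "HOL-Complex_Analysis.Complex_Analysis"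
begin

definition exp_type :: "(complex \<Rightarrow> complex) \<Rightarrow> ereal" where
  "exp_type f = Inf {ereal \<beta> | \<beta>. \<exists>C::real. \<forall>z. cmod (f z) \<le> C * exp (\<beta> * cmod z)}"

definition separated :: "(int \<Rightarrow> real) \<Rightarrow> bool" where
  "separated x \<longleftrightarrow> (INF k. \<bar>x (k + 1) - x k\<bar>) > 0"

text \<open>For strictly increasing separated \<open>x\<close>, the index sets of the partial products are finite.\<close>

definition gen_partial_prod :: "(int \<Rightarrow> real) \<Rightarrow> real \<Rightarrow> complex \<Rightarrow> complex" where
  "gen_partial_prod x r z =
     (\<Prod>k\<in>{k. 0 < \<bar>x k\<bar> \<and> \<bar>x k\<bar> < r}. 1 - z / complex_of_real (x k))"

definition gen_fun :: "(int \<Rightarrow> real) \<Rightarrow> complex \<Rightarrow> complex" where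
  "gen_fun x z =
     z ^ (if 0 \<in> range x then 1 else 0) * Lim at_top (\<lambda>r. gen_partial_prod x r z)"

text \<open>Convergence of the product is required pointwise on the whole plane. For separated real \<open>x\<close>
  this amounts to convergence of the sums of \<open>1 / x k\<close> over \<open>0 < \<bar>x k\<bar> < r\<close> as \<open>r\<close> grows, so
  it already gives locally uniform convergence, and the generating function is entire.\<close>

definition sine_type :: "(int \<Rightarrow> real) \<Rightarrow> bool" where
  "sine_type x \<longleftrightarrow>
     (\<forall>z. \<exists>L. ((\<lambda>r. gen_partial_prod x r z) \<longlongrightarrow> L) at_top) \<and>
     (\<exists>\<beta>::real. exp_type (gen_fun x) = ereal (pi * \<beta>) \<and>
        (\<forall>\<epsilon>>0. \<exists>C1>0. \<exists>C2>0. \<forall>z. infdist z (range (\<lambda>k. complex_of_real (x k))) > \<epsilon> \<longrightarrow>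
           C1 \<le> exp (- pi * \<beta> * \<bar>Im z\<bar>) * cmod (gen_fun x z) \<and>
           exp (- pi * \<beta> * \<bar>Im z\<bar>) * cmod (gen_fun x z) \<le> C2))"

text \<open>For a sine-type generating function and bounded \<open>a\<close>, the summands are of order
  \<open>1 / k\<^sup>2\<close> locally uniformly in \<open>z\<close>, so the two-sided series converges absolutely and the
  unordered sum is its value.\<close>

definition bandlimited_interp ::
    "(int \<Rightarrow> real) \<Rightarrow> real \<Rightarrow> (int \<Rightarrow> complex) \<Rightarrow> complex \<Rightarrow> complex \<Rightarrow> complex" where
  "bandlimited_interp x xt a a0 z =
     a0 * gen_fun x z / gen_fun x (of_real xt) +
     (\<Sum>\<^sub>\<infinity>k. a k * Lim (at z) (\<lambda>z0.
        gen_fun x z0 / deriv (gen_fun x) (of_real (x k)) *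
        (1 / (z0 - of_real (x k)) - 1 / (of_real xt - of_real (x k)))))"

end

theory Submission imports Defs
begin

text \<open>
  Write \<open>S\<close> for the generating function and \<open>\<delta>\<close> for the infimum of the gaps. On the real axis
  \<open>S\<close> is bounded, \<open>\<bar>S t\<bar> \<le> B \<bar>t - x k\<bar>\<close> for every node, and \<open>\<bar>S' (x k)\<bar>\<close> is bounded below. All three
  follow from the sine-type estimate on the line \<open>Im z = 1\<close> by comparing the product factor by
  factor at two points, since all zeros are real (\<open>sine_type_bounds\<close>). Hence with
  \<open>c k = a k / S' (x k)\<close>, a bounded sequence, and away from the nodes,
  \<open>f t = a0 S t / S xt + S t \<Sum>k. c k (1 / (t - x k) - 1 / (xt - x k))\<close>.

  Fix a large \<open>N\<close> and let \<open>\<bar>t\<bar> \<le> \<delta> N / 4\<close>. The terms with \<open>\<bar>k\<bar> > N\<close> have size \<open>O(N / k\<^sup>2)\<close>, so their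
  sum is bounded whatever the signs of the coefficients (\<open>far_nodes_sum_le\<close>). The terms with
  \<open>\<bar>k\<bar> \<le> N\<close> split into the anchor sum \<open>\<Sum>\<bar>k\<bar>\<le>N. c k / (xt - x k)\<close> and the Cauchy sum
  \<open>\<Sum>\<bar>k\<bar>\<le>N. c k / (t - x k)\<close>. Multiplied by \<open>S t\<close>, the Cauchy sum differs by a bounded amount from
  a discrete Hilbert transform on the lattice of cells of length \<open>\<delta>\<close>
  (\<open>cauchy_sum_le_lattice_transform\<close>). That transform is bounded on square-summable sequences
  (\<open>discrete_hilbert_inequality\<close>); applied to \<open>2 N + 1\<close> bounded coefficients it has a bounded mean
  over the \<open>O(N)\<close> cells that meet \<open>[-\<delta> N / 4, \<delta> N / 4]\<close>. So the average of \<open>\<bar>f\<bar>\<close> over this interval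
  is bounded by a constant plus a multiple of the anchor sum (\<open>interp_averages_bounded\<close>).

  Randomness is needed only for the anchor sums, which may grow like \<open>ln N\<close> for unfavourable
  coefficients. For orthogonal \<open>a k\<close> the anchor sum is a random series with square-summable
  weights, and along \<open>N = 4^n\<close> it is almost surely bounded (\<open>AE_bounded_random_partial_sums\<close>).
\<close>

section \<open>Sums over the integers and the discrete Hilbert transform\<close>

lemma sum_inverse_square_tail_le:
  fixes F :: "int set" and N :: nat
  assumes "finite F" "N > 0" "\<And>k. k \<in> F \<Longrightarrow> \<bar>k\<bar> > int N"
  shows "(\<Sum>k\<in>F. 1 / (real_of_int k)\<^sup>2) \<le> 2 / real N"
proof -
  have step: "(\<Sum>k\<in>{k. int N < \<bar>k\<bar> \<and> \<bar>k\<bar> \<le> int (N + M)}. 1 / (real_of_int k)\<^sup>2)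
      \<le> 2 / real N - 2 / real (N + M)" for M
  proof (induction M)
    case 0
    have "{k. int N < \<bar>k\<bar> \<and> \<bar>k\<bar> \<le> int (N + 0)} = {}" by auto
    then show ?case by (metis (no_types, lifting) add.right_neutral diff_self order_refl sum.empty)
  next
    case (Suc M)
    define Q where "Q = N + M"
    have Q: "Q \<ge> 1" using assms(2) by (simp add: Q_def)
    let ?A = "{k. int N < \<bar>k\<bar> \<and> \<bar>k\<bar> \<le> int (N + M)}"
    have eq: "{k. int N < \<bar>k\<bar> \<and> \<bar>k\<bar> \<le> int (N + Suc M)} = ?A \<union> {int Q + 1, - int Q - 1}"
      by (auto simp: Q_def)
    have fin: "finite ?A" by (rule finite_subset[of _ "{- int (N+M)..int (N+M)}"]) auto
    have "(\<Sum>k\<in>{k. int N < \<bar>k\<bar> \<and> \<bar>k\<bar> \<le> int (N + Suc M)}. 1 / (real_of_int k)\<^sup>2)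
        = (\<Sum>k\<in>?A. 1 / (real_of_int k)\<^sup>2) + (\<Sum>k\<in>{int Q + 1, - int Q - 1}. 1 / (real_of_int k)\<^sup>2)"
      unfolding eq using fin by (intro sum.union_disjoint) (auto simp: Q_def)
    also have "(\<Sum>k\<in>{int Q + 1, - int Q - 1}. 1 / (real_of_int k)\<^sup>2) = 2 / (real Q + 1)\<^sup>2"
    proof -
      have "(- real Q - 1)\<^sup>2 = (real Q + 1)\<^sup>2" by (simp add: power2_eq_square algebra_simps)
      then show ?thesis by (subst sum.insert) auto
    qed
    also have "2 / (real Q + 1)\<^sup>2 \<le> 2 / real Q - 2 / (real Q + 1)"
    proof -
      have "2 / real Q - 2 / (real Q + 1) = 2 / (real Q * (real Q + 1))"
        using Q by (simp add: field_simps)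
      also have "\<dots> \<ge> 2 / (real Q + 1)\<^sup>2"
        using Q by (intro divide_left_mono) (auto simp: power2_eq_square)
      finally show ?thesis .
    qed
    finally show ?case using Suc by (simp add: Q_def algebra_simps)
  qed
  obtain B where B: "\<And>k. k \<in> F \<Longrightarrow> \<bar>k\<bar> \<le> B"
    using assms(1) by (meson finite_imageI finite_subset Max_ge imageI)
  have "(\<Sum>k\<in>F. 1 / (real_of_int k)\<^sup>2)
      \<le> (\<Sum>k\<in>{k. int N < \<bar>k\<bar> \<and> \<bar>k\<bar> \<le> int (N + nat B)}. 1 / (real_of_int k)\<^sup>2)"
  proof (rule sum_mono2)
    show "finite {k. int N < \<bar>k\<bar> \<and> \<bar>k\<bar> \<le> int (N + nat B)}"
      by (rule finite_subset[of _ "{- int (N+nat B)..int (N+nat B)}"]) auto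
    show "F \<subseteq> {k. int N < \<bar>k\<bar> \<and> \<bar>k\<bar> \<le> int (N + nat B)}"
      using assms(3) B by force
  qed auto
  also have "\<dots> \<le> 2 / real N - 2 / real (N + nat B)" by (rule step)
  also have "\<dots> \<le> 2 / real N" by simp
  finally show ?thesis .
qed

text \<open>The injection \<open>p\<close> lets a sum over nodes be compared with a sum over all integers: below,
  \<open>p k\<close> counts lattice cells between a fixed point and the \<open>k\<close>-th node, and distinct nodes lie
  in distinct cells.\<close>
lemma sum_inverse_one_plus_square_le:
  fixes p :: "'i \<Rightarrow> int"
  assumes "finite F" "inj_on p F"
  shows "(\<Sum>k\<in>F. 1 / (1 + (real_of_int (p k))\<^sup>2)) \<le> 5"
proof -
  let ?g = "\<lambda>j::int. 1 / (1 + (real_of_int j)\<^sup>2)"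
  let ?G = "p ` F"
  have "(\<Sum>k\<in>F. ?g (p k)) = (\<Sum>j\<in>?G. ?g j)"
    using assms by (simp add: sum.reindex)
  also have "\<dots> \<le> (\<Sum>j\<in>{-1,0,1} \<union> (?G - {-1,0,1}). ?g j)"
    using assms by (intro sum_mono2) auto
  also have "\<dots> = (\<Sum>j\<in>{-1,0,1}. ?g j) + (\<Sum>j\<in>?G - {-1,0,1}. ?g j)"
    using assms by (intro sum.union_disjoint) auto
  also have "(\<Sum>j\<in>{-1,0,1::int}. ?g j) = 2" by simp
  also have "(\<Sum>j\<in>?G - {-1,0,1}. ?g j) \<le> (\<Sum>j\<in>?G - {-1,0,1}. 1 / (real_of_int j)\<^sup>2)"
    by (intro sum_mono divide_left_mono) (auto simp: zero_less_mult_iff add_pos_nonneg)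
  also have "\<dots> \<le> 2 / real 1"
    using assms by (intro sum_inverse_square_tail_le) auto
  finally show ?thesis by simp
qed

text \<open>The principal value of \<open>\<Sum>n. 1 / (n - m)\<close> is zero for \<open>m = 0\<close> by oddness, and replacing
  \<open>m\<close> by \<open>m + 1\<close> changes a symmetric partial sum only by two boundary terms. The term at
  \<open>n = m\<close> vanishes because \<open>1 / 0 = 0\<close>.\<close>
lemma sum_inverse_int_shift_tendsto_0:
  "(\<lambda>L. \<Sum>n\<in>{- int L..int L}. 1 / real_of_int (n - m)) \<longlonglongrightarrow> 0"
proof -
  define A where "A m L = (\<Sum>n\<in>{- int L..int L}. 1 / real_of_int (n - m))" for m L
  have A0: "A 0 L = 0" for L
  proof -
    have "A 0 L = (\<Sum>n\<in>{- int L..int L}. 1 / real_of_int (- n))"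
      unfolding A_def by (rule sum.reindex_bij_witness[of _ uminus uminus]) auto
    also have "\<dots> = - A 0 L" by (simp add: A_def sum_negf)
    finally show ?thesis by simp
  qed
  have diff: "A (m + 1) L - A m L = 1 / real_of_int (- int L - m - 1) - 1 / real_of_int (int L - m)" for m L
  proof -
    have "A (m + 1) L = (\<Sum>n\<in>{- int L - 1..int L - 1}. 1 / real_of_int (n - m))"
      unfolding A_def by (rule sum.reindex_bij_witness[of _ "\<lambda>n. n + 1" "\<lambda>n. n - 1"]) auto
    also have "\<dots> = 1 / real_of_int (- int L - 1 - m) + (\<Sum>n\<in>{- int L..int L - 1}. 1 / real_of_int (n - m))"
    proof -
      have "{- int L - 1..int L - 1} = insert (- int L - 1) {- int L..int L - 1}" by auto
      then show ?thesis by simp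
    qed
    also have "(\<Sum>n\<in>{- int L..int L - 1}. 1 / real_of_int (n - m)) = A m L - 1 / real_of_int (int L - m)"
    proof -
      have "{- int L..int L} = insert (int L) {- int L..int L - 1}" by auto
      then show ?thesis by (simp add: A_def)
    qed
    finally show ?thesis by (simp add: algebra_simps)
  qed
  have z: "(\<lambda>L. 1 / real_of_int (- int L - m - 1) - 1 / real_of_int (int L - m)) \<longlonglongrightarrow> 0" for m
  proof -
    have "(\<lambda>L. 1 / (- real L - real_of_int m - 1)) \<longlonglongrightarrow> 0"
         "(\<lambda>L. 1 / (real L - real_of_int m)) \<longlonglongrightarrow> 0" by real_asymp+
    from tendsto_diff[OF this] show ?thesis by simp
  qed
  have "(\<lambda>L. A m L) \<longlonglongrightarrow> 0"
  proof (induction m rule: int_induct[where k = 0])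
    case base show ?case by (simp add: A0)
  next
    case (step1 i)
    have "A (i + 1) = (\<lambda>L. A i L + (1 / real_of_int (- int L - i - 1) - 1 / real_of_int (int L - i)))"
      using diff[of i] by (auto simp: fun_eq_iff algebra_simps)
    with tendsto_add[OF step1(2) z[of i]] show ?case by simp
  next
    case (step2 i)
    have "A (i - 1) = (\<lambda>L. A i L - (1 / real_of_int (- int L - (i - 1) - 1) - 1 / real_of_int (int L - (i - 1))))"
      using diff[of "i - 1"] by (auto simp: fun_eq_iff algebra_simps)
    with tendsto_diff[OF step2(2) z[of "i - 1"]] show ?case by simp
  qed
  then show ?thesis by (simp add: A_def)
qed

text \<open>Partial fractions reduce the product to a difference of two principal values, both zero.
  What remains is the correction at the two singular indices \<open>n = m\<close> and \<open>n = m'\<close>, where the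
  product is zero by convention but the partial fraction expression is not.\<close>
lemma sum_inverse_product_tendsto:
  assumes "m \<noteq> m'"
  shows "(\<lambda>L. \<Sum>n\<in>{- int L..int L}. 1 / real_of_int (n - m) * (1 / real_of_int (n - m')))
           \<longlonglongrightarrow> 2 / (real_of_int (m - m'))\<^sup>2"
proof -
  define q where "q = real_of_int (m - m')"
  have q: "q \<noteq> 0" using assms by (simp add: q_def)
  have pf: "1 / real_of_int (n - m) * (1 / real_of_int (n - m'))
      = 1 / q * (1 / real_of_int (n - m) - 1 / real_of_int (n - m'))
        + 1 / q\<^sup>2 * ((if n = m then 1 else 0) + (if n = m' then 1 else 0))" for n
  proof -
    consider "n = m" | "n = m'" "n \<noteq> m" | "n \<noteq> m" "n \<noteq> m'" by blast
    then show ?thesis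
    proof cases
      case 1 then show ?thesis using assms by (simp add: q_def power2_eq_square)
    next
      case 2
      then have "real_of_int (n - m) = - q" by (simp add: q_def)
      with 2 show ?thesis using assms q by (simp add: power2_eq_square)
    next
      case 3
      then have "real_of_int (n - m) \<noteq> 0" "real_of_int (n - m') \<noteq> 0"
        "real_of_int (n - m') = real_of_int (n - m) + q" by (auto simp: q_def)
      with 3 show ?thesis using q by (simp add: field_simps)
    qed
  qed
  let ?A = "\<lambda>m L. \<Sum>n\<in>{- int L..int L}. 1 / real_of_int (n - m)"
  have "(\<lambda>L. 1 / q * (?A m L - ?A m' L) + 1 / q\<^sup>2 * 2) \<longlonglongrightarrow> 1 / q * (0 - 0) + 1 / q\<^sup>2 * 2"
    by (intro tendsto_intros sum_inverse_int_shift_tendsto_0)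
  moreover have "eventually (\<lambda>L. (\<Sum>n\<in>{- int L..int L}. 1 / real_of_int (n - m) * (1 / real_of_int (n - m')))
      = 1 / q * (?A m L - ?A m' L) + 1 / q\<^sup>2 * 2) sequentially"
    using eventually_ge_at_top[of "nat (\<bar>m\<bar> + \<bar>m'\<bar>)"]
  proof eventually_elim
    case (elim L)
    then have mem: "m \<in> {- int L..int L}" "m' \<in> {- int L..int L}" by auto
    have "(\<Sum>n\<in>{- int L..int L}. (if n = m then 1 else 0) + (if n = m' then 1 else 0)) = (2::real)"
      using mem by (simp add: sum.distrib)
    then show ?case
      unfolding pf sum.distrib sum_distrib_left[symmetric] sum_subtractf by simp
  qed
  ultimately show ?thesis
    unfolding q_def[symmetric] by (simp add: tendsto_cong)
qed

lemma norm_sum_scaleR_square: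
  fixes v :: "'i \<Rightarrow> 'b::real_inner"
  shows "(norm (\<Sum>i\<in>D. h i *\<^sub>R v i))\<^sup>2 = (\<Sum>i\<in>D. \<Sum>j\<in>D. (h i * h j) * inner (v i) (v j))"
  unfolding power2_norm_eq_inner inner_sum_left
  by (intro sum.cong refl) (simp add: inner_sum_right sum_distrib_left mult_ac)

text \<open>Expanding the square gives a quadratic form in \<open>d\<close> whose kernel is, in the limit of large
  summation ranges, \<open>2 / (m - m')\<^sup>2\<close> off the diagonal. The cancellation between the two sides
  of a singularity is what makes this kernel summable, so Schur's test applies; taking absolute
  values first would lose a logarithmic factor. Because the left side only grows with \<open>F\<close>, one
  sufficiently large symmetric range is enough and no infinite sum occurs.\<close>
lemma discrete_hilbert_inequality:
  fixes d :: "int \<Rightarrow> 'a::real_inner"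
  assumes "finite D" "finite F"
  shows "(\<Sum>n\<in>F. (norm (\<Sum>m\<in>D. (1 / real_of_int (n - m)) *\<^sub>R d m))\<^sup>2) \<le> 50 * (\<Sum>m\<in>D. (norm (d m))\<^sup>2)"
proof -
  define K where "K L m m' = (\<Sum>n\<in>{- int L..int L}. 1 / real_of_int (n - m) * (1 / real_of_int (n - m')))"
    for L m m'
  have Kb: "eventually (\<lambda>L. \<bar>K L m m'\<bar> \<le> 10 / (1 + (real_of_int (m - m'))\<^sup>2)) sequentially" for m m'
  proof (cases "m = m'")
    case True
    have "\<bar>K L m m'\<bar> \<le> 10" for L
    proof -
      have "\<bar>K L m m'\<bar> \<le> (\<Sum>n\<in>{- int L..int L}. 2 * (1 / (1 + (real_of_int (n - m))\<^sup>2)))"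
        unfolding K_def True
      proof (rule order_trans[OF sum_abs], rule sum_mono)
        fix n
        show "\<bar>1 / real_of_int (n - m') * (1 / real_of_int (n - m'))\<bar> \<le> 2 * (1 / (1 + (real_of_int (n - m'))\<^sup>2))"
        proof (cases "n = m'")
          case False
          then have "1 \<le> \<bar>real_of_int (n - m')\<bar>" by linarith
          then have "1 \<le> (real_of_int (n - m'))\<^sup>2" by (metis one_le_power power2_abs)
          then have "1 / (real_of_int (n - m'))\<^sup>2 \<le> 2 * (1 / (1 + (real_of_int (n - m'))\<^sup>2))"
            by (simp add: divide_simps)
          then show ?thesis by (simp add: power2_eq_square)
        qed simp
      qed
      also have "\<dots> = 2 * (\<Sum>n\<in>{- int L..int L}. (1 / (1 + (real_of_int (n - m))\<^sup>2)))"
        by (rule sum_distrib_left[symmetric])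
      also have "\<dots> \<le> 2 * 5"
        by (intro mult_left_mono sum_inverse_one_plus_square_le) (auto simp: inj_on_def)
      finally show ?thesis by simp
    qed
    then show ?thesis using True by simp
  next
    case False
    then have "1 \<le> \<bar>real_of_int (m - m')\<bar>" by linarith
    then have q1: "1 \<le> (real_of_int (m - m'))\<^sup>2" by (metis one_le_power power2_abs)
    have "2 / (real_of_int (m - m'))\<^sup>2 < 3 / (real_of_int (m - m'))\<^sup>2"
      using q1 by (intro divide_strict_right_mono) auto
    moreover have "- 3 / (real_of_int (m - m'))\<^sup>2 < 2 / (real_of_int (m - m'))\<^sup>2"
      using q1 by (intro divide_strict_right_mono) auto
    moreover have lim: "(\<lambda>L. K L m m') \<longlonglongrightarrow> 2 / (real_of_int (m - m'))\<^sup>2"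
      unfolding K_def by (rule sum_inverse_product_tendsto[OF False])
    ultimately have "eventually (\<lambda>L. K L m m' < 3 / (real_of_int (m - m'))\<^sup>2) sequentially"
      and "eventually (\<lambda>L. - 3 / (real_of_int (m - m'))\<^sup>2 < K L m m') sequentially"
      by (blast intro: order_tendstoD[OF lim])+
    then show ?thesis
    proof eventually_elim
      case (elim L)
      then have "\<bar>K L m m'\<bar> \<le> 3 / (real_of_int (m - m'))\<^sup>2" by auto
      also have "\<dots> \<le> 10 / (1 + (real_of_int (m - m'))\<^sup>2)"
        using q1 by (simp add: divide_simps)
      finally show ?case .
    qed
  qed
  have "eventually (\<lambda>L. \<forall>m\<in>D. \<forall>m'\<in>D. \<bar>K L m m'\<bar> \<le> 10 / (1 + (real_of_int (m - m'))\<^sup>2)) sequentially"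
    using assms(1) Kb by (intro eventually_ball_finite ballI) auto
  moreover have "eventually (\<lambda>L. F \<subseteq> {- int L..int L}) sequentially"
  proof -
    have "eventually (\<lambda>L. \<forall>n\<in>F. n \<in> {- int L..int L}) sequentially"
    proof (intro eventually_ball_finite ballI assms(2))
      show "eventually (\<lambda>L. n \<in> {- int L..int L}) sequentially" for n
        using eventually_ge_at_top[of "nat \<bar>n\<bar>"] by eventually_elim auto
    qed
    then show ?thesis by (auto elim: eventually_mono)
  qed
  (* D is finite, so one L serves all pairs of indices *)
  ultimately have "eventually (\<lambda>L. (\<forall>m\<in>D. \<forall>m'\<in>D. \<bar>K L m m'\<bar> \<le> 10 / (1 + (real_of_int (m - m'))\<^sup>2))
      \<and> F \<subseteq> {- int L..int L}) sequentially"
    by (rule eventually_conj)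
  then obtain L where KL: "\<And>m m'. m \<in> D \<Longrightarrow> m' \<in> D \<Longrightarrow> \<bar>K L m m'\<bar> \<le> 10 / (1 + (real_of_int (m - m'))\<^sup>2)"
    and FL: "F \<subseteq> {- int L..int L}"
    by (metis (no_types, lifting) eventually_happens' sequentially_bot)
  let ?w = "\<lambda>m m'. 1 / (1 + (real_of_int (m - m'))\<^sup>2)"
  have "(\<Sum>n\<in>F. (norm (\<Sum>m\<in>D. (1 / real_of_int (n - m)) *\<^sub>R d m))\<^sup>2)
      \<le> (\<Sum>n\<in>{- int L..int L}. (norm (\<Sum>m\<in>D. (1 / real_of_int (n - m)) *\<^sub>R d m))\<^sup>2)"
    using FL by (intro sum_mono2) auto
  also have "\<dots> = (\<Sum>n\<in>{- int L..int L}. \<Sum>m\<in>D. \<Sum>m'\<in>D.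
        (1 / real_of_int (n - m) * (1 / real_of_int (n - m'))) * inner (d m) (d m'))"
    by (simp only: norm_sum_scaleR_square)
  also have "\<dots> = (\<Sum>m\<in>D. \<Sum>m'\<in>D. K L m m' * inner (d m) (d m'))"
  proof (subst sum.swap, rule sum.cong[OF refl])
    fix m
    show "(\<Sum>n\<in>{- int L..int L}. \<Sum>m'\<in>D.
        (1 / real_of_int (n - m) * (1 / real_of_int (n - m'))) * inner (d m) (d m'))
        = (\<Sum>m'\<in>D. K L m m' * inner (d m) (d m'))"
      by (subst sum.swap) (simp only: K_def sum_distrib_right)
  qed
  also have "\<dots> \<le> (\<Sum>m\<in>D. \<Sum>m'\<in>D. 5 * (?w m m' * (norm (d m))\<^sup>2) + 5 * (?w m m' * (norm (d m'))\<^sup>2))"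
  proof (intro sum_mono)
    fix m m' assume mm: "m \<in> D" "m' \<in> D"
    have "K L m m' * inner (d m) (d m') \<le> \<bar>K L m m'\<bar> * \<bar>inner (d m) (d m')\<bar>"
      by (metis abs_ge_self abs_mult)
    also have "\<dots> \<le> (10 * ?w m m') * (norm (d m) * norm (d m'))"
      using KL[OF mm] by (intro mult_mono Cauchy_Schwarz_ineq2) auto
    also have "\<dots> \<le> (10 * ?w m m') * (((norm (d m))\<^sup>2 + (norm (d m'))\<^sup>2) / 2)"
      using sum_squares_bound[of "norm (d m)" "norm (d m')"]
      by (intro mult_left_mono) (auto simp: add_nonneg_nonneg)
    also have "\<dots> = 5 * (?w m m' * (norm (d m))\<^sup>2) + 5 * (?w m m' * (norm (d m'))\<^sup>2)"
      by (simp add: algebra_simps add_divide_distrib)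
    finally show "K L m m' * inner (d m) (d m')
        \<le> 5 * (?w m m' * (norm (d m))\<^sup>2) + 5 * (?w m m' * (norm (d m'))\<^sup>2)" .
  qed
  also have "\<dots> = 5 * (\<Sum>m\<in>D. (\<Sum>m'\<in>D. ?w m m') * (norm (d m))\<^sup>2)
      + 5 * (\<Sum>m'\<in>D. (\<Sum>m\<in>D. ?w m m') * (norm (d m'))\<^sup>2)"
  proof -
    have "(\<Sum>m\<in>D. \<Sum>m'\<in>D. 5 * (?w m m' * (norm (d m'))\<^sup>2)) = (\<Sum>m'\<in>D. \<Sum>m\<in>D. 5 * (?w m m' * (norm (d m'))\<^sup>2))"
      by (rule sum.swap)
    then show ?thesis
      by (simp only: sum.distrib sum_distrib_left sum_distrib_right)
  qed
  also have "\<dots> \<le> 5 * (\<Sum>m\<in>D. 5 * (norm (d m))\<^sup>2) + 5 * (\<Sum>m'\<in>D. 5 * (norm (d m'))\<^sup>2)"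
    using assms(1)
    by (intro add_mono mult_left_mono sum_mono mult_right_mono sum_inverse_one_plus_square_le)
       (auto simp: inj_on_def)
  also have "\<dots> = 50 * (\<Sum>m\<in>D. (norm (d m))\<^sup>2)"
    by (simp add: sum_distrib_left[symmetric])
  finally show ?thesis .
qed

section \<open>Separated node sequences\<close>

locale separated_seq =
  fixes x :: "int \<Rightarrow> real" and \<delta> :: real
  assumes \<delta>_pos: "\<delta> > 0" and gap: "\<delta> \<le> x (k + 1) - x k"
begin

lemma increment_ge: "j \<le> k \<Longrightarrow> \<delta> * real_of_int (k - j) \<le> x k - x j"
proof (induction k rule: int_ge_induct)
  case (step i)
  then show ?case using gap[of i] by (simp add: algebra_simps)
qed simp

lemma dist_ge: "\<delta> * \<bar>real_of_int (k - j)\<bar> \<le> \<bar>x k - x j\<bar>"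
  using increment_ge[of j k] increment_ge[of k j] by (cases "j \<le> k") (auto simp: algebra_simps)

lemma abs_ge: "\<delta> * \<bar>real_of_int k\<bar> - \<bar>x 0\<bar> \<le> \<bar>x k\<bar>"
  using dist_ge[of k 0] by auto

lemma finite_bounded_indices: "finite {k. \<bar>x k\<bar> < r}"
proof (rule finite_subset)
  show "{k. \<bar>x k\<bar> < r} \<subseteq> {- \<lceil>(r + \<bar>x 0\<bar>) / \<delta>\<rceil>..\<lceil>(r + \<bar>x 0\<bar>) / \<delta>\<rceil>}"
  proof
    fix k assume "k \<in> {k. \<bar>x k\<bar> < r}"
    then have "\<bar>real_of_int k\<bar> * \<delta> \<le> r + \<bar>x 0\<bar>" using abs_ge[of k] by (simp add: mult.commute)
    then have "\<bar>real_of_int k\<bar> \<le> (r + \<bar>x 0\<bar>) / \<delta>" using \<delta>_pos by (simp add: pos_le_divide_eq)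
    then have "real_of_int \<bar>k\<bar> \<le> (r + \<bar>x 0\<bar>) / \<delta>" by simp
    then have "\<bar>k\<bar> \<le> \<lceil>(r + \<bar>x 0\<bar>) / \<delta>\<rceil>" by linarith
    then show "k \<in> {- \<lceil>(r + \<bar>x 0\<bar>) / \<delta>\<rceil>..\<lceil>(r + \<bar>x 0\<bar>) / \<delta>\<rceil>}" by auto
  qed
qed simp

lemma inj_cell: "inj (\<lambda>k. \<lfloor>(x k - y) / \<delta>\<rfloor>)"
proof (rule linorder_injI)
  fix j k :: int assume "j < k"
  then have "1 \<le> real_of_int (k - j)" by linarith
  then have "\<delta> * 1 \<le> \<delta> * real_of_int (k - j)" using \<delta>_pos by (intro mult_left_mono) auto
  also have "\<dots> \<le> x k - x j" using \<open>j < k\<close> by (intro increment_ge) auto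
  finally have "1 \<le> (x k - x j) / \<delta>" using \<delta>_pos by simp
  then have "(x j - y) / \<delta> + 1 \<le> (x k - y) / \<delta>" by (simp add: diff_divide_distrib)
  then show "\<lfloor>(x j - y) / \<delta>\<rfloor> \<noteq> \<lfloor>(x k - y) / \<delta>\<rfloor>" by linarith
qed

lemma sum_inverse_square_dist_le:
  assumes "finite F" "\<rho> > 0" "\<And>k. k \<in> F \<Longrightarrow> \<rho> \<le> \<bar>x k - y\<bar>"
  shows "(\<Sum>k\<in>F. 1 / (x k - y)\<^sup>2) \<le> 5 * (3 / \<rho>\<^sup>2 + 2 / \<delta>\<^sup>2)"
proof -
  define K where "K = 3 / \<rho>\<^sup>2 + 2 / \<delta>\<^sup>2"
  define p where "p = (\<lambda>k. \<lfloor>(x k - y) / \<delta>\<rfloor>)"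
  have K: "K > 0" using assms(2) \<delta>_pos by (simp add: K_def add_pos_pos)
  have "1 / (x k - y)\<^sup>2 \<le> K * (1 / (1 + (real_of_int (p k))\<^sup>2))" if k: "k \<in> F" for k
  proof -
    define s where "s = (x k - y) / \<delta>"
    have "\<bar>real_of_int (p k)\<bar> \<le> \<bar>s\<bar> + 1" unfolding p_def s_def by linarith
    then have "(real_of_int (p k))\<^sup>2 \<le> (\<bar>s\<bar> + 1)\<^sup>2" by (metis abs_ge_zero power2_abs power_mono)
    also have "\<dots> \<le> 2 * s\<^sup>2 + 2"
      using zero_le_power2[of "\<bar>s\<bar> - 1"] by (simp add: power2_eq_square algebra_simps)
    finally have 1: "1 + (real_of_int (p k))\<^sup>2 \<le> 3 + 2 * s\<^sup>2" by simp
    have "\<rho>\<^sup>2 \<le> (x k - y)\<^sup>2" using assms(2,3)[OF] k by (metis less_eq_real_def power2_abs power_mono)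
    then have "1 \<le> (x k - y)\<^sup>2 / \<rho>\<^sup>2" using assms(2) by simp
    then have "3 + 2 * s\<^sup>2 \<le> 3 * ((x k - y)\<^sup>2 / \<rho>\<^sup>2) + 2 * s\<^sup>2" by simp
    also have "\<dots> = K * (x k - y)\<^sup>2" by (simp add: K_def s_def power_divide algebra_simps)
    finally have "1 + (real_of_int (p k))\<^sup>2 \<le> K * (x k - y)\<^sup>2" using 1 by simp
    moreover have "(x k - y)\<^sup>2 > 0" using assms(2,3) k by fastforce
    moreover have "1 + (real_of_int (p k))\<^sup>2 > 0" by (simp add: add_pos_nonneg)
    ultimately show ?thesis by (simp add: divide_simps mult.commute)
  qed
  then have "(\<Sum>k\<in>F. 1 / (x k - y)\<^sup>2) \<le> (\<Sum>k\<in>F. K * (1 / (1 + (real_of_int (p k))\<^sup>2)))"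
    by (rule sum_mono)
  also have "\<dots> = K * (\<Sum>k\<in>F. 1 / (1 + (real_of_int (p k))\<^sup>2))" by (rule sum_distrib_left[symmetric])
  also have "\<dots> \<le> K * 5"
    using K assms(1) inj_cell[of y] unfolding p_def
    by (intro mult_left_mono sum_inverse_one_plus_square_le) (auto intro: inj_on_subset)
  finally show ?thesis by (simp add: K_def mult.commute)
qed

text \<open>A possible node at the origin contributes the factor \<open>z\<close> and any other node \<open>1 - z / x k\<close>.
  In both cases the modulus is a constant times the distance to the node, so products at two
  points can be compared factor by factor.\<close>
definition node_factor :: "int \<Rightarrow> complex \<Rightarrow> complex" where
  "node_factor k z = (if x k = 0 then z else 1 - z / complex_of_real (x k))"

lemma norm_node_factor:
  "cmod (node_factor k z) = (if x k = 0 then 1 else 1 / \<bar>x k\<bar>) * cmod (z - complex_of_real (x k))"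
proof (cases "x k = 0")
  case False
  then have "1 - z / complex_of_real (x k) = - (z - complex_of_real (x k)) / complex_of_real (x k)"
    by (simp add: field_simps)
  then show ?thesis using False by (simp add: node_factor_def norm_divide del: minus_diff_eq)
qed (simp add: node_factor_def)

lemma norm_node_factor_mono:
  assumes "cmod (z - complex_of_real (x k)) \<le> C * cmod (w - complex_of_real (x k))"
  shows "cmod (node_factor k z) \<le> C * cmod (node_factor k w)"
proof -
  define g where "g = (if x k = 0 then 1 else 1 / \<bar>x k\<bar>)"
  have "g \<ge> 0" by (simp add: g_def)
  from mult_left_mono[OF assms this] show ?thesis
    unfolding norm_node_factor g_def[symmetric] by (simp only: mult.left_commute)
qed

lemma prod_node_factor_eq:
  assumes "r > 0"
  shows "(\<Prod>k\<in>{k. \<bar>x k\<bar> < r}. node_factor k z)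
       = z ^ (if 0 \<in> range x then 1 else 0) * gen_partial_prod x r z"
proof -
  let ?I = "{k. 0 < \<bar>x k\<bar> \<and> \<bar>x k\<bar> < r}"
  have finI: "finite ?I" by (rule finite_subset[OF _ finite_bounded_indices[of r]]) auto
  have I: "(\<Prod>k\<in>?I. node_factor k z) = gen_partial_prod x r z"
    unfolding gen_partial_prod_def by (intro prod.cong) (auto simp: node_factor_def)
  have inj: "x j = x k \<Longrightarrow> j = k" for j k
    using dist_ge[of j k] \<delta>_pos by (auto simp: mult_le_0_iff)
  show ?thesis
  proof (cases "0 \<in> range x")
    case True
    then obtain k0 where k0: "x k0 = 0" by auto
    have "{k. \<bar>x k\<bar> < r} = insert k0 ?I" using k0 inj assms by force
    then show ?thesis using True k0 finI I by (simp add: node_factor_def)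
  next
    case False
    then have "{k. \<bar>x k\<bar> < r} = ?I" by force
    then show ?thesis using False I by simp
  qed
qed

end

section \<open>The generating function\<close>

locale convergent_seq = separated_seq +
  assumes conv: "\<exists>L. ((\<lambda>r. gen_partial_prod x r z) \<longlongrightarrow> L) at_top"
begin

lemma partial_prod_tendsto:
  "((\<lambda>r. gen_partial_prod x r z) \<longlongrightarrow> Lim at_top (\<lambda>r. gen_partial_prod x r z)) at_top"
  using conv[of z] tendsto_Lim[of at_top "\<lambda>r. gen_partial_prod x r z"] by auto

lemma prod_node_factor_tendsto:
  "((\<lambda>r. \<Prod>k\<in>{k. \<bar>x k\<bar> < r}. node_factor k z) \<longlongrightarrow> gen_fun x z) at_top"
proof -
  have "((\<lambda>r. z ^ (if 0 \<in> range x then 1 else 0) * gen_partial_prod x r z) \<longlongrightarrow> gen_fun x z) at_top"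
    unfolding gen_fun_def by (intro tendsto_mult_left partial_prod_tendsto)
  moreover have "eventually (\<lambda>r. z ^ (if 0 \<in> range x then 1 else 0) * gen_partial_prod x r z
      = (\<Prod>k\<in>{k. \<bar>x k\<bar> < r}. node_factor k z)) at_top"
    using eventually_gt_at_top[of 0] by eventually_elim (simp add: prod_node_factor_eq)
  ultimately show ?thesis by (rule Lim_transform_eventually)
qed

lemma norm_gen_fun_le:
  assumes "eventually (\<lambda>r. cmod (\<Prod>k\<in>{k. \<bar>x k\<bar> < r}. node_factor k z)
      \<le> C * cmod (\<Prod>k\<in>{k. \<bar>x k\<bar> < r}. node_factor k w)) at_top"
  shows "cmod (gen_fun x z) \<le> C * cmod (gen_fun x w)"
  by (rule tendsto_le[OF _ _ _ assms])
     (auto intro!: tendsto_intros prod_node_factor_tendsto)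

lemma gen_fun_node: "gen_fun x (complex_of_real (x k)) = 0"
proof (rule tendsto_unique[OF _ prod_node_factor_tendsto])
  have "eventually (\<lambda>r. 0 = (\<Prod>j\<in>{j. \<bar>x j\<bar> < r}. node_factor j (complex_of_real (x k)))) at_top"
    using eventually_gt_at_top[of "\<bar>x k\<bar>"]
  proof eventually_elim
    case (elim r)
    then show ?case using finite_bounded_indices[of r]
      by (intro prod_zero[symmetric]) (auto simp: node_factor_def)
  qed
  then show "((\<lambda>r. \<Prod>j\<in>{j. \<bar>x j\<bar> < r}. node_factor j (complex_of_real (x k))) \<longlongrightarrow> 0) at_top"
    by (rule Lim_transform_eventually[OF tendsto_const])
qed simp

text \<open>All nodes are real, so moving away from the real axis increases every factor.\<close>
lemma gen_fun_real_le_shift: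
  "cmod (gen_fun x (complex_of_real t)) \<le> cmod (gen_fun x (Complex t 1))"
proof -
  have "cmod (gen_fun x (complex_of_real t)) \<le> 1 * cmod (gen_fun x (Complex t 1))"
  proof (intro norm_gen_fun_le always_eventually allI)
    fix r
    show "cmod (\<Prod>k\<in>{k. \<bar>x k\<bar> < r}. node_factor k (complex_of_real t))
        \<le> 1 * cmod (\<Prod>k\<in>{k. \<bar>x k\<bar> < r}. node_factor k (Complex t 1))"
      unfolding prod_norm[symmetric] mult_1
    proof (intro prod_mono conjI norm_ge_zero)
      fix k
      show "cmod (node_factor k (complex_of_real t)) \<le> cmod (node_factor k (Complex t 1))"
        using norm_node_factor_mono[of "complex_of_real t" k 1 "Complex t 1"]
        by (simp add: cmod_def real_le_rsqrt)
    qed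
  qed
  then show ?thesis by simp
qed

text \<open>As before, except that for the node \<open>x k\<close> the shifted factor is larger at least by the
  ratio \<open>1 / \<bar>t - x k\<bar>\<close>, since the shifted point has distance at least 1 from the node. This
  replaces an application of the maximum principle to \<open>S(z) / (z - x k)\<close>.\<close>
lemma gen_fun_real_le_dist:
  "cmod (gen_fun x (complex_of_real t)) \<le> \<bar>t - x k\<bar> * cmod (gen_fun x (Complex t 1))"
proof (rule norm_gen_fun_le)
  show "eventually (\<lambda>r. cmod (\<Prod>j\<in>{j. \<bar>x j\<bar> < r}. node_factor j (complex_of_real t))
      \<le> \<bar>t - x k\<bar> * cmod (\<Prod>j\<in>{j. \<bar>x j\<bar> < r}. node_factor j (Complex t 1))) at_top"
    using eventually_gt_at_top[of "\<bar>x k\<bar>"]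
  proof eventually_elim
    case (elim r)
    let ?J = "{j. \<bar>x j\<bar> < r}"
    have fin: "finite ?J" and k: "k \<in> ?J" using finite_bounded_indices elim by auto
    have 1: "cmod (node_factor j (complex_of_real t)) \<le> cmod (node_factor j (Complex t 1))" for j
      using norm_node_factor_mono[of "complex_of_real t" j 1 "Complex t 1"]
      by (simp add: cmod_def real_le_rsqrt)
    have 2: "cmod (node_factor k (complex_of_real t)) \<le> \<bar>t - x k\<bar> * cmod (node_factor k (Complex t 1))"
    proof -
      have "cmod (complex_of_real t - complex_of_real (x k)) = \<bar>t - x k\<bar>"
        by (metis norm_of_real of_real_diff)
      moreover have "1 \<le> cmod (Complex t 1 - complex_of_real (x k))"
        by (simp add: cmod_def)
      then have "\<bar>t - x k\<bar> * 1 \<le> \<bar>t - x k\<bar> * cmod (Complex t 1 - complex_of_real (x k))"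
        by (intro mult_left_mono) auto
      ultimately show ?thesis by (intro norm_node_factor_mono) simp
    qed
    have "(\<Prod>j\<in>?J. cmod (node_factor j (complex_of_real t)))
        = cmod (node_factor k (complex_of_real t)) * (\<Prod>j\<in>?J - {k}. cmod (node_factor j (complex_of_real t)))"
      using fin k by (simp add: prod.remove)
    also have "\<dots> \<le> (\<bar>t - x k\<bar> * cmod (node_factor k (Complex t 1)))
        * (\<Prod>j\<in>?J - {k}. cmod (node_factor j (Complex t 1)))"
      using 1 2 by (intro mult_mono prod_mono prod_nonneg) auto
    also have "\<dots> = \<bar>t - x k\<bar> * (\<Prod>j\<in>?J. cmod (node_factor j (Complex t 1)))"
      using fin k by (simp add: prod.remove)
    finally show ?case by (simp add: prod_norm)
  qed
qed

text \<open>Moving up from \<open>x k + i \<eta>\<close> to \<open>x k + i\<close> multiplies the factor of \<open>x k\<close> by exactly \<open>1 / \<eta>\<close>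
  and that of another node at distance \<open>d\<close> by at most \<open>sqrt (1 + 1 / d\<^sup>2) \<le> exp (1 / d\<^sup>2)\<close>. By
  separation the exponents have a bounded sum. The constant does not depend on \<open>\<eta>\<close>, so letting
  \<open>\<eta>\<close> tend to zero will bound the derivative at the node from below.\<close>
lemma gen_fun_vertical_growth:
  assumes "\<eta> > 0"
  shows "cmod (gen_fun x (Complex (x k) 1)) \<le> exp (25 / \<delta>\<^sup>2) / \<eta> * cmod (gen_fun x (Complex (x k) \<eta>))"
proof (rule norm_gen_fun_le)
  show "eventually (\<lambda>r. cmod (\<Prod>j\<in>{j. \<bar>x j\<bar> < r}. node_factor j (Complex (x k) 1))
      \<le> exp (25 / \<delta>\<^sup>2) / \<eta> * cmod (\<Prod>j\<in>{j. \<bar>x j\<bar> < r}. node_factor j (Complex (x k) \<eta>))) at_top"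
    using eventually_gt_at_top[of "\<bar>x k\<bar>"]
  proof eventually_elim
    case (elim r)
    let ?J = "{j. \<bar>x j\<bar> < r}"
    have fin: "finite ?J" and k: "k \<in> ?J" using finite_bounded_indices elim by auto
    have norm_shift: "cmod (Complex (x k) s - complex_of_real (x j)) = sqrt ((x k - x j)\<^sup>2 + s\<^sup>2)" for s j
      by (simp add: cmod_def)
    have 1: "cmod (node_factor j (Complex (x k) 1))
        \<le> exp (1 / (x j - x k)\<^sup>2) * cmod (node_factor j (Complex (x k) \<eta>))" if "j \<in> ?J - {k}" for j
    proof -
      define D where "D = (x j - x k)\<^sup>2"
      have "j \<noteq> k" using that by simp
      then have "x j \<noteq> x k" using dist_ge[of j k] \<delta>_pos by (auto simp: mult_le_0_iff)
      then have D: "D > 0" by (simp add: D_def)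
      have D': "(x k - x j)\<^sup>2 = D" by (simp add: D_def power2_commute)
      have "sqrt (D + 1) = sqrt (D * (1 + 1 / D))" using D by (simp add: field_simps)
      also have "\<dots> \<le> sqrt ((D + \<eta>\<^sup>2) * (exp (1 / D))\<^sup>2)"
      proof -
        have "1 + 1 / D \<le> exp (1 / D)" by (rule exp_ge_add_one_self)
        also have "\<dots> \<le> (exp (1 / D))\<^sup>2" using D by (simp add: power2_eq_square)
        finally show ?thesis using D by (intro real_sqrt_le_mono mult_mono) auto
      qed
      also have "\<dots> = exp (1 / D) * sqrt (D + \<eta>\<^sup>2)" by (simp add: real_sqrt_mult mult.commute)
      finally have "cmod (Complex (x k) 1 - complex_of_real (x j))
          \<le> exp (1 / D) * cmod (Complex (x k) \<eta> - complex_of_real (x j))"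
        by (simp add: norm_shift D')
      then show ?thesis unfolding D_def[symmetric] by (rule norm_node_factor_mono)
    qed
    have 2: "cmod (node_factor k (Complex (x k) 1)) = 1 / \<eta> * cmod (node_factor k (Complex (x k) \<eta>))"
      using assms by (simp add: norm_node_factor norm_shift)
    have 3: "(\<Sum>j\<in>?J - {k}. 1 / (x j - x k)\<^sup>2) \<le> 25 / \<delta>\<^sup>2"
    proof -
      have "\<delta> \<le> \<bar>x j - x k\<bar>" if "j \<noteq> k" for j
      proof -
        have "1 \<le> \<bar>real_of_int (j - k)\<bar>" using that by linarith
        then have "\<delta> * 1 \<le> \<delta> * \<bar>real_of_int (j - k)\<bar>" using \<delta>_pos by (intro mult_left_mono) auto
        then show ?thesis using dist_ge[of j k] by simp
      qed
      then have "(\<Sum>j\<in>?J - {k}. 1 / (x j - x k)\<^sup>2) \<le> 5 * (3 / \<delta>\<^sup>2 + 2 / \<delta>\<^sup>2)"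
        using fin \<delta>_pos by (intro sum_inverse_square_dist_le) auto
      then show ?thesis by (simp add: field_simps)
    qed
    have "(\<Prod>j\<in>?J. cmod (node_factor j (Complex (x k) 1)))
        = cmod (node_factor k (Complex (x k) 1)) * (\<Prod>j\<in>?J - {k}. cmod (node_factor j (Complex (x k) 1)))"
      using fin k by (simp add: prod.remove)
    also have "\<dots> \<le> (1 / \<eta> * cmod (node_factor k (Complex (x k) \<eta>)))
        * (\<Prod>j\<in>?J - {k}. exp (1 / (x j - x k)\<^sup>2) * cmod (node_factor j (Complex (x k) \<eta>)))"
      using 1 2 assms by (intro mult_mono prod_mono prod_nonneg) auto
    also have "\<dots> = exp (\<Sum>j\<in>?J - {k}. 1 / (x j - x k)\<^sup>2) / \<eta> * (\<Prod>j\<in>?J. cmod (node_factor j (Complex (x k) \<eta>)))"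
      using fin k by (simp add: prod.remove prod.distrib exp_sum)
    also have "\<dots> \<le> exp (25 / \<delta>\<^sup>2) / \<eta> * (\<Prod>j\<in>?J. cmod (node_factor j (Complex (x k) \<eta>)))"
      using 3 assms by (intro mult_right_mono divide_right_mono prod_nonneg) auto
    finally show ?case by (simp add: prod_norm)
  qed
qed

lemma nonzero_nodes_bounded_below: "\<exists>\<rho>>0. \<forall>k. x k \<noteq> 0 \<longrightarrow> \<rho> \<le> \<bar>x k\<bar>"
proof -
  let ?A = "insert 1 ((\<lambda>k. \<bar>x k\<bar>) ` {k. 0 < \<bar>x k\<bar> \<and> \<bar>x k\<bar> < 1})"
  have fin: "finite ?A"
    by (intro finite.insertI finite_imageI finite_subset[OF _ finite_bounded_indices[of 1]]) auto
  have "Min ?A > 0" using fin by (subst Min_gr_iff) auto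
  moreover have "Min ?A \<le> \<bar>x k\<bar>" if "x k \<noteq> 0" for k
  proof (cases "\<bar>x k\<bar> < 1")
    case True then show ?thesis using that fin by (intro Min_le) auto
  next
    case False
    have "Min ?A \<le> 1" using fin by (intro Min_le) auto
    then show ?thesis using False by simp
  qed
  ultimately show ?thesis by blast
qed

text \<open>For a real \<open>u\<close> so small that all \<open>u / x k\<close> are at most \<open>1/2\<close> in modulus, the logarithm of the
  partial product is \<open>- u \<Sum> 1 / x k\<close> up to a bounded error, because the squares \<open>1 / (x k)\<^sup>2\<close>
  are summable. Convergence of the product at \<open>u\<close> bounds this from above; using \<open>u\<close> and
  \<open>- u\<close> bounds the reciprocal sums on both sides.\<close>
lemma reciprocal_sums_bounded:
  "\<exists>B. eventually (\<lambda>r. \<bar>\<Sum>k\<in>{k. 0 < \<bar>x k\<bar> \<and> \<bar>x k\<bar> < r}. 1 / x k\<bar> \<le> B) at_top"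
proof -
  obtain \<rho> where \<rho>: "\<rho> > 0" "\<And>k. x k \<noteq> 0 \<Longrightarrow> \<rho> \<le> \<bar>x k\<bar>"
    using nonzero_nodes_bounded_below by blast
  define V where "V = 5 * (3 / \<rho>\<^sup>2 + 2 / \<delta>\<^sup>2)"
  let ?I = "\<lambda>r. {k. 0 < \<bar>x k\<bar> \<and> \<bar>x k\<bar> < r}"
  have finI: "finite (?I r)" for r by (rule finite_subset[OF _ finite_bounded_indices[of r]]) auto
  have V: "(\<Sum>k\<in>?I r. 1 / (x k)\<^sup>2) \<le> V" for r
    using sum_inverse_square_dist_le[OF finI \<rho>(1), of r 0] \<rho>(2) by (simp add: V_def)
  have one: "\<exists>C. eventually (\<lambda>r. - u * (\<Sum>k\<in>?I r. 1 / x k) \<le> C) at_top"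
    if u: "\<bar>u\<bar> \<le> \<rho> / 2" for u
  proof -
    define L where "L = Lim at_top (\<lambda>r. gen_partial_prod x r (complex_of_real u))"
    have "eventually (\<lambda>r. cmod (gen_partial_prod x r (complex_of_real u)) < cmod L + 1) at_top"
      using tendsto_norm[OF partial_prod_tendsto[of "complex_of_real u"]]
      by (intro order_tendstoD(2)) (auto simp: L_def)
    then have "eventually (\<lambda>r. - u * (\<Sum>k\<in>?I r. 1 / x k) \<le> ln (cmod L + 1) + 2 * u\<^sup>2 * V) at_top"
    proof eventually_elim
      case (elim r)
      have fac: "exp (- (u / x k) - 2 * (u / x k)\<^sup>2) \<le> cmod (1 - complex_of_real u / complex_of_real (x k))"
        if k: "k \<in> ?I r" for k
      proof -
        define w where "w = u / x k"
        have "\<bar>w\<bar> \<le> 1 / 2"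
          using \<rho>(2)[of k] k u by (simp add: w_def abs_divide divide_simps)
        then have "\<bar>ln (1 + - w) - - w\<bar> \<le> 2 * (- w)\<^sup>2"
          by (intro abs_ln_one_plus_x_minus_x_bound) auto
        then have "- w - 2 * w\<^sup>2 \<le> ln (1 - w)" by (simp add: abs_le_iff)
        moreover have "1 - w > 0" using \<open>\<bar>w\<bar> \<le> 1 / 2\<close> by auto
        ultimately have "exp (- w - 2 * w\<^sup>2) \<le> 1 - w" by (metis exp_le_cancel_iff exp_ln)
        also have "\<dots> \<le> cmod (complex_of_real (1 - w))" unfolding norm_of_real by simp
        finally show ?thesis by (simp add: w_def)
      qed
      have "exp (\<Sum>k\<in>?I r. - (u / x k) - 2 * (u / x k)\<^sup>2)
          = (\<Prod>k\<in>?I r. exp (- (u / x k) - 2 * (u / x k)\<^sup>2))" using finI by (rule exp_sum)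
      also have "\<dots> \<le> (\<Prod>k\<in>?I r. cmod (1 - complex_of_real u / complex_of_real (x k)))"
        using fac by (intro prod_mono) auto
      also have "\<dots> = cmod (gen_partial_prod x r (complex_of_real u))"
        by (simp add: gen_partial_prod_def prod_norm)
      also have "\<dots> < cmod L + 1" by (rule elim)
      finally have "(\<Sum>k\<in>?I r. - (u / x k) - 2 * (u / x k)\<^sup>2) \<le> ln (cmod L + 1)"
        by (smt (verit) exp_gt_zero ln_exp ln_mono)
      moreover have "(\<Sum>k\<in>?I r. - (u / x k) - 2 * (u / x k)\<^sup>2)
          = - u * (\<Sum>k\<in>?I r. 1 / x k) - 2 * u\<^sup>2 * (\<Sum>k\<in>?I r. 1 / (x k)\<^sup>2)"
        by (simp add: sum_subtractf sum_negf sum_distrib_left power_divide)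
      moreover have "2 * u\<^sup>2 * (\<Sum>k\<in>?I r. 1 / (x k)\<^sup>2) \<le> 2 * u\<^sup>2 * V"
        using V by (intro mult_left_mono) auto
      ultimately show ?case by linarith
    qed
    then show ?thesis by blast
  qed
  from one[of "\<rho> / 2"] one[of "- \<rho> / 2"] \<rho>(1) obtain C1 C2 where ev:
    "eventually (\<lambda>r. - (\<rho> / 2) * (\<Sum>k\<in>?I r. 1 / x k) \<le> C1) at_top"
    "eventually (\<lambda>r. - (- \<rho> / 2) * (\<Sum>k\<in>?I r. 1 / x k) \<le> C2) at_top" by auto
  have bd: "\<bar>s\<bar> \<le> max C1 C2 / (\<rho> / 2)"
    if "- (\<rho> / 2) * s \<le> C1" "- (- \<rho> / 2) * s \<le> C2" for s
  proof -
    have "\<bar>s\<bar> * (\<rho> / 2) \<le> max C1 C2" using that by (cases "s \<ge> 0") (auto simp: mult.commute le_max_iff_disj)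
    then show ?thesis using \<rho>(1) by (simp add: pos_le_divide_eq del: divide_divide_eq_right)
  qed
  from ev have "eventually (\<lambda>r. \<bar>\<Sum>k\<in>?I r. 1 / x k\<bar> \<le> max C1 C2 / (\<rho> / 2)) at_top"
    by eventually_elim (rule bd)
  then show ?thesis by blast
qed

text \<open>Since \<open>\<bar>1 - z / x\<bar>\<^sup>2 = 1 - 2 Re z / x + \<bar>z\<bar>\<^sup>2 / x\<^sup>2\<close> is at most the exponential of the last two
  terms, only the sums of \<open>1 / x k\<close> and of their squares enter.\<close>
lemma norm_partial_prod_le:
  assumes "(\<Sum>k\<in>{k. 0 < \<bar>x k\<bar> \<and> \<bar>x k\<bar> < r}. 1 / (x k)\<^sup>2) \<le> V"
    and "\<bar>\<Sum>k\<in>{k. 0 < \<bar>x k\<bar> \<and> \<bar>x k\<bar> < r}. 1 / x k\<bar> \<le> B"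
  shows "cmod (gen_partial_prod x r z) \<le> exp (cmod z * B + (cmod z)\<^sup>2 * V)"
proof (rule power2_le_imp_le)
  let ?I = "{k. 0 < \<bar>x k\<bar> \<and> \<bar>x k\<bar> < r}"
  have finI: "finite ?I" by (rule finite_subset[OF _ finite_bounded_indices[of r]]) auto
  have V0: "V \<ge> 0" using assms(1) by (smt (verit) sum_nonneg zero_le_divide_1_iff zero_le_power2)
  have "(cmod (gen_partial_prod x r z))\<^sup>2 = (\<Prod>k\<in>?I. (cmod (1 - z / complex_of_real (x k)))\<^sup>2)"
    by (simp add: gen_partial_prod_def prod_norm[symmetric] prod_power_distrib)
  also have "\<dots> \<le> (\<Prod>k\<in>?I. exp (- 2 * Re z * (1 / x k) + (cmod z)\<^sup>2 * (1 / (x k)\<^sup>2)))"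
  proof (intro prod_mono conjI)
    fix k assume "k \<in> ?I"
    then have "x k \<noteq> 0" by auto
    have "Re (1 - z / complex_of_real (x k)) = 1 - Re z / x k" "Im (1 - z / complex_of_real (x k)) = - (Im z / x k)"
      by (simp_all add: Re_divide_of_real Im_divide_of_real)
    then have "(cmod (1 - z / complex_of_real (x k)))\<^sup>2 = (1 - Re z / x k)\<^sup>2 + (Im z / x k)\<^sup>2"
      by (simp only: cmod_power2 power2_minus)
    also have "\<dots> = 1 + (- 2 * Re z * (1 / x k) + (cmod z)\<^sup>2 * (1 / (x k)\<^sup>2))"
      using \<open>x k \<noteq> 0\<close> unfolding cmod_power2[of z] by (simp add: power2_eq_square field_simps)
    finally have "(cmod (1 - z / complex_of_real (x k)))\<^sup>2
        = 1 + (- 2 * Re z * (1 / x k) + (cmod z)\<^sup>2 * (1 / (x k)\<^sup>2))" .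
    then show "(cmod (1 - z / complex_of_real (x k)))\<^sup>2
        \<le> exp (- 2 * Re z * (1 / x k) + (cmod z)\<^sup>2 * (1 / (x k)\<^sup>2))"
      by (simp only: exp_ge_add_one_self)
  qed simp
  also have "\<dots> = exp (\<Sum>k\<in>?I. - 2 * Re z * (1 / x k) + (cmod z)\<^sup>2 * (1 / (x k)\<^sup>2))"
    using finI by (rule exp_sum[symmetric])
  also have "\<dots> \<le> exp (2 * (cmod z * B + (cmod z)\<^sup>2 * V))"
  proof -
    define \<sigma>1 where "\<sigma>1 = (\<Sum>k\<in>?I. 1 / x k)"
    define \<sigma>2 where "\<sigma>2 = (\<Sum>k\<in>?I. 1 / (x k)\<^sup>2)"
    have "(\<Sum>k\<in>?I. - 2 * Re z * (1 / x k) + (cmod z)\<^sup>2 * (1 / (x k)\<^sup>2))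
        = - 2 * (Re z * \<sigma>1) + (cmod z)\<^sup>2 * \<sigma>2"
      by (simp add: \<sigma>1_def \<sigma>2_def sum.distrib sum_distrib_left mult_ac sum_negf sum_subtractf)
    also have "\<dots> \<le> 2 * (cmod z * B + (cmod z)\<^sup>2 * V)"
    proof -
      have "\<bar>Re z * \<sigma>1\<bar> \<le> cmod z * B"
        unfolding abs_mult \<sigma>1_def using assms(2) by (intro mult_mono abs_Re_le_cmod) auto
      then have "- (Re z * \<sigma>1) \<le> cmod z * B" by (rule abs_le_D2)
      moreover have "(cmod z)\<^sup>2 * \<sigma>2 \<le> (cmod z)\<^sup>2 * V"
        unfolding \<sigma>2_def using assms(1) by (intro mult_left_mono) auto
      moreover have "(cmod z)\<^sup>2 * V \<ge> 0" using V0 by simp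
      ultimately show ?thesis unfolding distrib_left by linarith
    qed
    finally show ?thesis by (subst exp_le_cancel_iff)
  qed
  also have "\<dots> = (exp (cmod z * B + (cmod z)\<^sup>2 * V))\<^sup>2" by (rule exp_double)
  finally show "(cmod (gen_partial_prod x r z))\<^sup>2 \<le> (exp (cmod z * B + (cmod z)\<^sup>2 * V))\<^sup>2" .
qed simp

text \<open>The partial products are locally bounded, so by Montel's theorem a subsequence converges to a
  holomorphic function; pointwise convergence identifies it with the limit in the definition of
  the generating function.\<close>
lemma gen_fun_entire: "gen_fun x holomorphic_on UNIV"
proof -
  let ?I = "\<lambda>r. {k. 0 < \<bar>x k\<bar> \<and> \<bar>x k\<bar> < r}"
  obtain \<rho> where \<rho>: "\<rho> > 0" "\<And>k. x k \<noteq> 0 \<Longrightarrow> \<rho> \<le> \<bar>x k\<bar>"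
    using nonzero_nodes_bounded_below by blast
  define V where "V = 5 * (3 / \<rho>\<^sup>2 + 2 / \<delta>\<^sup>2)"
  have finI: "finite (?I r)" for r by (rule finite_subset[OF _ finite_bounded_indices[of r]]) auto
  have V: "(\<Sum>k\<in>?I r. 1 / (x k)\<^sup>2) \<le> V" for r
    using sum_inverse_square_dist_le[OF finI \<rho>(1), of r 0] \<rho>(2) by (simp add: V_def)
  obtain B r0 where B: "\<And>r. r \<ge> r0 \<Longrightarrow> \<bar>\<Sum>k\<in>?I r. 1 / x k\<bar> \<le> B"
    using reciprocal_sums_bounded by (auto simp: eventually_at_top_linorder)
  define P where "P n = gen_partial_prod x (r0 + real n)" for n
  have bd: "cmod (P n z) \<le> exp (cmod z * B + (cmod z)\<^sup>2 * V)" for n z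
    unfolding P_def using V B by (intro norm_partial_prod_le) auto
  have V0: "V \<ge> 0" by (simp add: V_def)
  have B0: "B \<ge> 0" using B[of r0] by auto
  have limP: "(\<lambda>n. P n z) \<longlonglongrightarrow> Lim at_top (\<lambda>r. gen_partial_prod x r z)" for z
    unfolding P_def
    by (rule filterlim_compose[OF partial_prod_tendsto]) real_asymp
  have "(\<lambda>z. Lim at_top (\<lambda>r. gen_partial_prod x r z)) holomorphic_on UNIV"
  proof (rule Montel[of UNIV "range P" P])
    show "h holomorphic_on UNIV" if "h \<in> range P" for h
      using that by (auto simp: P_def gen_partial_prod_def[abs_def] intro!: holomorphic_intros)
    show "\<exists>C. \<forall>h\<in>range P. \<forall>z\<in>K. cmod (h z) \<le> C" if K: "compact K" for K
    proof -
      obtain R where R: "\<And>z. z \<in> K \<Longrightarrow> cmod z \<le> R"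
        using compact_imp_bounded[OF K] by (auto simp: bounded_iff)
      have "cmod (P n z) \<le> exp (R * B + R\<^sup>2 * V)" if "z \<in> K" for n z
      proof -
        have "cmod z * B + (cmod z)\<^sup>2 * V \<le> R * B + R\<^sup>2 * V"
          using R[OF that] B0 V0 by (intro add_mono mult_right_mono power_mono) auto
        then show ?thesis using bd[of n z] by (meson exp_le_cancel_iff order_trans)
      qed
      then show ?thesis by blast
    qed
  next
    fix g and s :: "nat \<Rightarrow> nat"
    assume g: "g holomorphic_on UNIV" "strict_mono s"
      and lim: "\<And>z. z \<in> UNIV \<Longrightarrow> (\<lambda>n. P (s n) z) \<longlonglongrightarrow> g z"
    have "g = (\<lambda>z. Lim at_top (\<lambda>r. gen_partial_prod x r z))"
    proof
      fix z
      have "(\<lambda>n. P (s n) z) \<longlonglongrightarrow> Lim at_top (\<lambda>r. gen_partial_prod x r z)"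
        using LIMSEQ_subseq_LIMSEQ[OF limP g(2)] by (simp add: o_def)
      then show "g z = Lim at_top (\<lambda>r. gen_partial_prod x r z)"
        using lim[of z] LIMSEQ_unique by blast
    qed
    with g(1) show ?thesis by simp
  qed auto
  then show ?thesis
    unfolding gen_fun_def[abs_def] by (intro holomorphic_intros)
qed

lemma deriv_gen_fun_lower_bound:
  assumes "c > 0" "c \<le> cmod (gen_fun x (Complex (x k) 1))"
  shows "c * exp (- (25 / \<delta>\<^sup>2)) \<le> cmod (deriv (gen_fun x) (complex_of_real (x k)))"
proof -
  let ?S = "gen_fun x" and ?p = "complex_of_real (x k)"
  have "(?S has_field_derivative deriv ?S ?p) (at ?p)"
    using gen_fun_entire by (intro holomorphic_derivI[of _ UNIV]) auto
  then have "((\<lambda>h. (?S (?p + h) - ?S ?p) / h) \<longlongrightarrow> deriv ?S ?p) (at 0)"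
    by (simp add: DERIV_def)
  then have "(\<lambda>n. (?S (?p + Complex 0 (1 / real (Suc n))) - ?S ?p) / Complex 0 (1 / real (Suc n))) \<longlonglongrightarrow> deriv ?S ?p"
  proof (rule filterlim_compose)
    have "(\<lambda>n. 1 / real (Suc n)) \<longlonglongrightarrow> 0" by real_asymp
    then have "(\<lambda>n. Complex 0 (1 / real (Suc n))) \<longlonglongrightarrow> Complex 0 0"
      by (intro tendsto_Complex tendsto_const)
    then show "filterlim (\<lambda>n. Complex 0 (1 / real (Suc n))) (at 0) sequentially"
      by (auto simp: filterlim_at complex_eq_iff zero_complex.code)
  qed
  then have "(\<lambda>n. cmod ((?S (?p + Complex 0 (1 / real (Suc n))) - ?S ?p) / Complex 0 (1 / real (Suc n))))
      \<longlonglongrightarrow> cmod (deriv ?S ?p)" by (rule tendsto_norm)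
  then show ?thesis
  proof (rule LIMSEQ_le_const, intro exI allI impI)
    fix n :: nat
    define \<eta> where "\<eta> = 1 / real (Suc n)"
    have \<eta>: "\<eta> > 0" by (simp add: \<eta>_def)
    have "c \<le> exp (25 / \<delta>\<^sup>2) / \<eta> * cmod (?S (Complex (x k) \<eta>))"
      using gen_fun_vertical_growth[OF \<eta>, of k] assms by linarith
    then have "c * exp (- (25 / \<delta>\<^sup>2)) \<le> cmod (?S (Complex (x k) \<eta>)) / \<eta>"
      using \<eta> by (simp add: exp_minus field_simps)
    moreover have "?p + Complex 0 \<eta> = Complex (x k) \<eta>" by (simp add: complex_eq_iff)
    moreover have "cmod (Complex 0 \<eta>) = \<eta>" using \<eta> by (simp add: cmod_def)
    ultimately show "c * exp (- (25 / \<delta>\<^sup>2))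
        \<le> cmod ((?S (?p + Complex 0 (1 / real (Suc n))) - ?S ?p) / Complex 0 (1 / real (Suc n)))"
      unfolding \<eta>_def[symmetric] by (simp add: norm_divide gen_fun_node)
  qed
qed

end

text \<open>On the line \<open>Im z = 1\<close>, whose distance from the nodes is at least 1, the sine-type estimate
  bounds \<open>S\<close> above and below by positive constants. Factor-by-factor comparison carries these
  bounds to the real axis and to the derivatives at the nodes.\<close>
lemma sine_type_bounds:
  assumes "separated_seq x \<delta>" "sine_type x"
  obtains B c where "B > 0" "c > 0"
    "\<And>t. cmod (gen_fun x (complex_of_real t)) \<le> B"
    "\<And>t k. cmod (gen_fun x (complex_of_real t)) \<le> B * \<bar>t - x k\<bar>"
    "\<And>k. c \<le> cmod (deriv (gen_fun x) (complex_of_real (x k)))"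
    "gen_fun x holomorphic_on UNIV"
proof -
  interpret separated_seq x \<delta> by fact
  interpret convergent_seq x \<delta>
    using assms(2) by unfold_locales (auto simp: sine_type_def)
  obtain \<beta> where \<beta>: "\<forall>\<epsilon>>0. \<exists>C1>0. \<exists>C2>0. \<forall>z. infdist z (range (\<lambda>k. complex_of_real (x k))) > \<epsilon> \<longrightarrow>
           C1 \<le> exp (- pi * \<beta> * \<bar>Im z\<bar>) * cmod (gen_fun x z) \<and>
           exp (- pi * \<beta> * \<bar>Im z\<bar>) * cmod (gen_fun x z) \<le> C2"
    using assms(2) by (auto simp: sine_type_def)
  have "(0::real) < 1 / 2" by simp
  from \<beta>[rule_format, OF this] obtain C1 C2 where C: "C1 > 0" "C2 > 0"
    and bd: "\<And>z. infdist z (range (\<lambda>k. complex_of_real (x k))) > 1 / 2 \<Longrightarrow>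
           C1 \<le> exp (- pi * \<beta> * \<bar>Im z\<bar>) * cmod (gen_fun x z) \<and>
           exp (- pi * \<beta> * \<bar>Im z\<bar>) * cmod (gen_fun x z) \<le> C2" by blast
  have line: "C1 * exp (pi * \<beta>) \<le> cmod (gen_fun x (Complex t 1))"
       "cmod (gen_fun x (Complex t 1)) \<le> C2 * exp (pi * \<beta>)" for t
  proof -
    have "1 \<le> infdist (Complex t 1) (range (\<lambda>k. complex_of_real (x k)))"
      unfolding infdist_def by (auto intro!: cINF_greatest simp: dist_norm cmod_def)
    then have "infdist (Complex t 1) (range (\<lambda>k. complex_of_real (x k))) > 1 / 2" by linarith
    from bd[OF this] show "C1 * exp (pi * \<beta>) \<le> cmod (gen_fun x (Complex t 1))"
       "cmod (gen_fun x (Complex t 1)) \<le> C2 * exp (pi * \<beta>)"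
      by (simp_all add: exp_minus field_simps)
  qed
  show thesis
  proof (rule that[of "C2 * exp (pi * \<beta>)" "C1 * exp (pi * \<beta>) * exp (- (25 / \<delta>\<^sup>2))"])
    show "cmod (gen_fun x (complex_of_real t)) \<le> C2 * exp (pi * \<beta>)" for t
      using gen_fun_real_le_shift line(2) by (rule order_trans)
    show "cmod (gen_fun x (complex_of_real t)) \<le> C2 * exp (pi * \<beta>) * \<bar>t - x k\<bar>" for t k
    proof -
      have "cmod (gen_fun x (complex_of_real t)) \<le> \<bar>t - x k\<bar> * cmod (gen_fun x (Complex t 1))"
        by (rule gen_fun_real_le_dist)
      also have "\<dots> \<le> \<bar>t - x k\<bar> * (C2 * exp (pi * \<beta>))" using line(2) by (intro mult_left_mono) auto
      finally show ?thesis by (simp add: mult_ac)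
    qed
    show "C1 * exp (pi * \<beta>) * exp (- (25 / \<delta>\<^sup>2)) \<le> cmod (deriv (gen_fun x) (complex_of_real (x k)))" for k
      using C line(1) by (intro deriv_gen_fun_lower_bound) auto
  qed (use C gen_fun_entire in auto)
qed

section \<open>Cauchy sums over separated nodes\<close>

context separated_seq
begin

text \<open>A discrete Hilbert transform of \<open>d\<close>, after each node has been replaced by the number of the
  cell \<open>[\<delta> m, \<delta> (m + 1))\<close> that contains it; a term with the node in cell \<open>n\<close> itself is zero.\<close>
definition lattice_transform :: "int set \<Rightarrow> (int \<Rightarrow> complex) \<Rightarrow> int \<Rightarrow> complex" where
  "lattice_transform D d n = (\<Sum>k\<in>D. (1 / real_of_int (n - \<lfloor>x k / \<delta>\<rfloor>)) *\<^sub>R d k)"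

lemma lattice_transform_square_sum_le:
  assumes "finite D" "finite F" "\<And>k. k \<in> D \<Longrightarrow> cmod (d k) \<le> A"
  shows "(\<Sum>n\<in>F. (cmod (lattice_transform D d n))\<^sup>2) \<le> 50 * A\<^sup>2 * real (card D)"
proof -
  define m where "m = (\<lambda>k. \<lfloor>x k / \<delta>\<rfloor>)"
  have inj: "inj m" using inj_cell[of 0] by (simp add: m_def)
  have m_eq: "\<lfloor>x k / \<delta>\<rfloor> = m k" for k by (simp add: m_def)
  have re: "lattice_transform D d n = (\<Sum>j\<in>m ` D. (1 / real_of_int (n - j)) *\<^sub>R d (inv m j))" for n
    unfolding lattice_transform_def m_eq
    by (subst sum.reindex) (auto simp: inv_f_f[OF inj] intro: inj_on_subset[OF inj])
  have "(\<Sum>n\<in>F. (cmod (lattice_transform D d n))\<^sup>2) \<le> 50 * (\<Sum>j\<in>m ` D. (cmod (d (inv m j)))\<^sup>2)"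
    unfolding re using assms by (intro discrete_hilbert_inequality) auto
  also have "(\<Sum>j\<in>m ` D. (cmod (d (inv m j)))\<^sup>2) = (\<Sum>k\<in>D. (cmod (d k))\<^sup>2)"
    by (subst sum.reindex) (auto simp: inv_f_f[OF inj] intro: inj_on_subset[OF inj])
  also have "\<dots> \<le> (\<Sum>k\<in>D. A\<^sup>2)" using assms(3) by (intro sum_mono power_mono) auto
  finally show ?thesis by (simp add: mult_ac)
qed

text \<open>Here \<open>s\<close> stands for the modulus of the generating function at \<open>t\<close>. For nodes at least
  two cells away, replacing \<open>t\<close> and the node by their cell numbers changes \<open>1 / (t - x k)\<close> by the
  order of the inverse square of the cell distance, which is summable over the nodes. In the same and the adjacent cells \<open>1 / (t - x k)\<close> is unbounded,
  but there \<open>s\<close> is small: it is at most \<open>B\<close> times the distance to the node.\<close>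
lemma cauchy_sum_le_lattice_transform:
  assumes "finite D" "\<And>k. k \<in> D \<Longrightarrow> cmod (d k) \<le> A" "A \<ge> 0"
    and "s \<ge> 0" "s \<le> B" "\<And>k. s \<le> B * \<bar>t - x k\<bar>" "t \<notin> range x"
  shows "s * cmod (\<Sum>k\<in>D. d k / complex_of_real (t - x k))
    \<le> 5 * A * B * (2 + 4 / \<delta>) + B / \<delta> * cmod (lattice_transform D d \<lfloor>t / \<delta>\<rfloor>)"
proof -
  define p where "p k = \<lfloor>t / \<delta>\<rfloor> - \<lfloor>x k / \<delta>\<rfloor>" for k
  define K where "K = B * (2 + 4 / \<delta>)"
  have B0: "B \<ge> 0" using assms(4,5) by simp
  have K0: "K \<ge> 0" using B0 \<delta>_pos by (simp add: K_def)
  have termwise: "s * \<bar>1 / (t - x k) - 1 / (\<delta> * real_of_int (p k))\<bar> \<le> K * (1 / (1 + (real_of_int (p k))\<^sup>2))" for k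
  proof (cases "\<bar>p k\<bar> \<le> 1")
    case True
    have tx: "\<bar>t - x k\<bar> > 0" using assms(7) by auto
    then have 1: "s * (1 / \<bar>t - x k\<bar>) \<le> B" using assms(6)[of k] by (simp add: pos_divide_le_eq)
    have "p k = 0 \<or> p k = 1 \<or> p k = - 1" using True by linarith
    then have "\<bar>1 / (\<delta> * real_of_int (p k))\<bar> \<le> 1 / \<delta>" and p2: "1 + (real_of_int (p k))\<^sup>2 \<le> 2"
      using \<delta>_pos by auto
    then have 2: "s * \<bar>1 / (\<delta> * real_of_int (p k))\<bar> \<le> B * (1 / \<delta>)"
      using assms(4,5) by (intro mult_mono) auto
    have "s * \<bar>1 / (t - x k) - 1 / (\<delta> * real_of_int (p k))\<bar>
        \<le> s * (\<bar>1 / (t - x k)\<bar> + \<bar>1 / (\<delta> * real_of_int (p k))\<bar>)"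
      using assms(4) by (intro mult_left_mono abs_triangle_ineq4)
    also have "\<dots> \<le> B + B * (1 / \<delta>)" using 1 2 by (simp add: distrib_left)
    also have "\<dots> \<le> K / 2" using B0 \<delta>_pos by (simp add: K_def algebra_simps divide_right_mono)
    also have "\<dots> \<le> K / (1 + (real_of_int (p k))\<^sup>2)"
      using p2 K0 by (intro divide_left_mono) (auto intro!: mult_pos_pos add_pos_nonneg)
    finally show ?thesis by simp
  next
    case False
    define \<tau> where "\<tau> = (t - x k) / \<delta>"
    define P where "P = real_of_int (p k)"
    have P2: "\<bar>P\<bar> \<ge> 2" using False unfolding P_def by linarith
    have \<tau>P: "\<bar>\<tau> - P\<bar> \<le> 1"
      unfolding \<tau>_def P_def p_def diff_divide_distrib of_int_diff by linarith
    then have \<tau>: "\<bar>\<tau>\<bar> \<ge> \<bar>P\<bar> / 2" using P2 by linarith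
    have tx: "t - x k = \<delta> * \<tau>" using \<delta>_pos by (simp add: \<tau>_def)
    have nz: "\<tau> \<noteq> 0" "P \<noteq> 0" using \<tau> P2 by auto
    have "\<bar>1 / (t - x k) - 1 / (\<delta> * P)\<bar> = \<bar>\<tau> - P\<bar> / (\<delta> * (\<bar>\<tau>\<bar> * \<bar>P\<bar>))"
    proof -
      have "1 / (t - x k) - 1 / (\<delta> * P) = (P - \<tau>) / (\<delta> * (\<tau> * P))"
        using nz \<delta>_pos unfolding tx by (simp add: field_simps)
      then show ?thesis using \<delta>_pos by (simp add: abs_divide abs_mult abs_minus_commute)
    qed
    also have "\<dots> \<le> 1 / (\<delta> * (\<bar>P\<bar> / 2 * \<bar>P\<bar>))"
      using \<tau>P \<tau> \<delta>_pos P2 nz by (intro frac_le mult_left_mono mult_right_mono mult_pos_pos) auto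
    also have "\<dots> = 2 / (\<delta> * P\<^sup>2)" by (simp add: power2_eq_square)
    also have "\<dots> \<le> 4 / \<delta> * (1 / (1 + P\<^sup>2))"
    proof -
      have "1 \<le> P\<^sup>2" using P2 by (metis one_le_numeral one_le_power order_trans power2_abs)
      then show ?thesis using \<delta>_pos by (simp add: divide_simps)
    qed
    finally have "\<bar>1 / (t - x k) - 1 / (\<delta> * P)\<bar> \<le> 4 / \<delta> * (1 / (1 + P\<^sup>2))" .
    then have "s * \<bar>1 / (t - x k) - 1 / (\<delta> * P)\<bar> \<le> B * (4 / \<delta> * (1 / (1 + P\<^sup>2)))"
      using assms(4,5) by (intro mult_mono) auto
    also have "\<dots> \<le> K * (1 / (1 + P\<^sup>2))"
      using B0 \<delta>_pos by (simp add: K_def algebra_simps add_divide_distrib[symmetric] divide_right_mono)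
    finally show ?thesis by (simp only: P_def)
  qed
  have split: "(\<Sum>k\<in>D. d k / complex_of_real (t - x k))
      = (\<Sum>k\<in>D. (1 / (t - x k) - 1 / (\<delta> * real_of_int (p k))) *\<^sub>R d k)
        + (1 / \<delta>) *\<^sub>R lattice_transform D d \<lfloor>t / \<delta>\<rfloor>"
    unfolding lattice_transform_def p_def[symmetric] scaleR_sum_right sum.distrib[symmetric]
    by (intro sum.cong refl) (simp add: scaleR_conv_of_real divide_inverse algebra_simps)
  have "s * cmod (\<Sum>k\<in>D. (1 / (t - x k) - 1 / (\<delta> * real_of_int (p k))) *\<^sub>R d k)
      \<le> s * (\<Sum>k\<in>D. \<bar>1 / (t - x k) - 1 / (\<delta> * real_of_int (p k))\<bar> * A)"
    using assms(2,4) by (intro mult_left_mono order_trans[OF norm_sum] sum_mono)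
      (auto intro!: mult_left_mono)
  also have "\<dots> = A * (\<Sum>k\<in>D. s * \<bar>1 / (t - x k) - 1 / (\<delta> * real_of_int (p k))\<bar>)"
    by (simp add: sum_distrib_left sum_distrib_right mult_ac)
  also have "\<dots> \<le> A * (\<Sum>k\<in>D. K * (1 / (1 + (real_of_int (p k))\<^sup>2)))"
    using termwise assms(3) by (intro mult_left_mono sum_mono) auto
  also have "\<dots> = A * (K * (\<Sum>k\<in>D. 1 / (1 + (real_of_int (p k))\<^sup>2)))"
    by (simp only: sum_distrib_left)
  also have "\<dots> \<le> A * (K * 5)"
  proof -
    have "inj_on p D" using inj_cell[of 0] by (auto simp: p_def inj_on_def)
    then show ?thesis
      using assms(1,3) K0 by (intro mult_left_mono sum_inverse_one_plus_square_le) auto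
  qed
  finally have 1: "s * cmod (\<Sum>k\<in>D. (1 / (t - x k) - 1 / (\<delta> * real_of_int (p k))) *\<^sub>R d k) \<le> A * (K * 5)" .
  have "s * cmod ((1 / \<delta>) *\<^sub>R lattice_transform D d \<lfloor>t / \<delta>\<rfloor>) \<le> B / \<delta> * cmod (lattice_transform D d \<lfloor>t / \<delta>\<rfloor>)"
    using assms(4,5) \<delta>_pos by (simp add: divide_right_mono mult_right_mono)
  moreover have "s * cmod (\<Sum>k\<in>D. d k / complex_of_real (t - x k))
      \<le> s * cmod (\<Sum>k\<in>D. (1 / (t - x k) - 1 / (\<delta> * real_of_int (p k))) *\<^sub>R d k)
        + s * cmod ((1 / \<delta>) *\<^sub>R lattice_transform D d \<lfloor>t / \<delta>\<rfloor>)"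
    unfolding split distrib_left[symmetric] using assms(4) by (intro mult_left_mono norm_triangle_ineq)
  ultimately show ?thesis using 1 by (simp add: K_def mult_ac)
qed

lemma cell_index_bounded:
  assumes "\<bar>t\<bar> \<le> \<delta> * real N"
  shows "\<lfloor>t / \<delta>\<rfloor> \<in> {- int N..int N}"
proof -
  have "- real N \<le> t / \<delta>" "t / \<delta> \<le> real N"
    using assms \<delta>_pos by (simp_all add: pos_le_divide_eq pos_divide_le_eq mult.commute)
  then show ?thesis by (simp, linarith)
qed

lemma nn_integral_cells_le:
  assumes "R \<le> \<delta> * real N" "\<And>n. g n \<ge> (0::real)"
  shows "(\<integral>\<^sup>+ t\<in>{-R..R}. ennreal (g \<lfloor>t / \<delta>\<rfloor>) \<partial>lborel) \<le> ennreal (\<delta> * (\<Sum>n\<in>{- int N..int N}. g n))"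
proof -
  let ?C = "\<lambda>n::int. {\<delta> * real_of_int n..<\<delta> * (real_of_int n + 1)}"
  have "(\<integral>\<^sup>+ t\<in>{-R..R}. ennreal (g \<lfloor>t / \<delta>\<rfloor>) \<partial>lborel)
      \<le> (\<integral>\<^sup>+ t. (\<Sum>n\<in>{- int N..int N}. ennreal (g n) * indicator (?C n) t) \<partial>lborel)"
  proof (rule nn_integral_mono)
    fix t
    show "ennreal (g \<lfloor>t / \<delta>\<rfloor>) * indicator {-R..R} t
        \<le> (\<Sum>n\<in>{- int N..int N}. ennreal (g n) * indicator (?C n) t)"
    proof (cases "t \<in> {-R..R}")
      case True
      define n where "n = \<lfloor>t / \<delta>\<rfloor>"
      have mem: "n \<in> {- int N..int N}"
        unfolding n_def using True assms(1) by (intro cell_index_bounded) auto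
      have "real_of_int n \<le> t / \<delta>" "t / \<delta> < real_of_int n + 1" by (simp_all add: n_def)
      then have "t \<in> ?C n" using \<delta>_pos by (simp add: pos_le_divide_eq pos_divide_less_eq mult.commute)
      then have "ennreal (g n) * indicator {-R..R} t \<le> ennreal (g n) * indicator (?C n) t"
        using True by simp
      also have "\<dots> \<le> (\<Sum>n\<in>{- int N..int N}. ennreal (g n) * indicator (?C n) t)"
        using mem by (intro member_le_sum) auto
      finally show ?thesis by (simp add: n_def)
    qed simp
  qed
  also have "\<dots> = (\<Sum>n\<in>{- int N..int N}. ennreal (g n) * ennreal \<delta>)"
  proof (subst nn_integral_sum)
    have "emeasure lborel (?C n) = ennreal \<delta>" for n
      using \<delta>_pos by (subst emeasure_lborel_Ico) (auto simp: algebra_simps)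
    then show "(\<Sum>n\<in>{- int N..int N}. \<integral>\<^sup>+ t. ennreal (g n) * indicator (?C n) t \<partial>lborel)
        = (\<Sum>n\<in>{- int N..int N}. ennreal (g n) * ennreal \<delta>)"
      by (intro sum.cong refl) (subst nn_integral_cmult_indicator, auto)
  qed auto
  also have "\<dots> = ennreal (\<delta> * (\<Sum>n\<in>{- int N..int N}. g n))"
    using assms(2) \<delta>_pos
    by (simp add: ennreal_mult[symmetric] sum_ennreal sum_distrib_left mult.commute)
  finally show ?thesis .
qed

text \<open>The difference is \<open>\<bar>s - t\<bar> / (\<bar>t - x k\<bar> \<bar>s - x k\<bar>)\<close>, which is \<open>O(N / k\<^sup>2)\<close> when \<open>s\<close> and \<open>t\<close> are
  \<open>O(N)\<close>, while the tail of \<open>\<Sum> 1 / k\<^sup>2\<close> beyond \<open>N\<close> is \<open>O(1 / N)\<close>. The bound is therefore uniform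
  in \<open>N\<close>.\<close>
lemma far_nodes_sum_le:
  assumes "N > 0" "4 * \<bar>x 0\<bar> \<le> \<delta> * real N" "\<bar>s\<bar> \<le> \<delta> * real N / 4" "\<bar>t\<bar> \<le> \<delta> * real N / 4"
    and "finite F" "\<And>k. k \<in> F \<Longrightarrow> \<bar>k\<bar> > int N"
  shows "(\<Sum>k\<in>F. \<bar>1 / (t - x k) - 1 / (s - x k)\<bar>) \<le> 4 / \<delta>"
proof -
  have far: "\<bar>u - x k\<bar> \<ge> \<delta> * \<bar>real_of_int k\<bar> / 2" if "\<bar>u\<bar> \<le> \<delta> * real N / 4" "k \<in> F" for u k
  proof -
    have "real N \<le> \<bar>real_of_int k\<bar>" using assms(6)[OF that(2)] by linarith
    then have "\<delta> * real N \<le> \<delta> * \<bar>real_of_int k\<bar>" using \<delta>_pos by simp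
    then show ?thesis using that(1) assms(2) abs_ge[of k] by linarith
  qed
  have "(\<Sum>k\<in>F. \<bar>1 / (t - x k) - 1 / (s - x k)\<bar>) \<le> (\<Sum>k\<in>F. 2 * real N / \<delta> * (1 / (real_of_int k)\<^sup>2))"
  proof (rule sum_mono)
    fix k assume k: "k \<in> F"
    have k0: "\<bar>real_of_int k\<bar> > 0" using assms(6)[OF k] by simp
    have pos: "\<delta> * \<bar>real_of_int k\<bar> / 2 > 0" using k0 \<delta>_pos by simp
    have nz: "t - x k \<noteq> 0" "s - x k \<noteq> 0" using far[OF assms(4) k] far[OF assms(3) k] pos by auto
    have st: "\<bar>s - t\<bar> \<le> \<delta> * real N / 2" using assms(3,4) by linarith
    have "1 / (t - x k) - 1 / (s - x k) = (s - t) / ((t - x k) * (s - x k))"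
      using nz by (simp add: field_simps)
    then have "\<bar>1 / (t - x k) - 1 / (s - x k)\<bar> = \<bar>s - t\<bar> / (\<bar>t - x k\<bar> * \<bar>s - x k\<bar>)"
      by (simp add: abs_mult)
    also have "\<dots> \<le> (\<delta> * real N / 2) / ((\<delta> * \<bar>real_of_int k\<bar> / 2) * (\<delta> * \<bar>real_of_int k\<bar> / 2))"
      using far[OF assms(4) k] far[OF assms(3) k] pos st order_trans[OF abs_ge_zero st]
      by (intro frac_le mult_mono mult_pos_pos) auto
    also have "\<dots> = 2 * real N / \<delta> * (1 / (real_of_int k)\<^sup>2)"
      using \<delta>_pos k0 by (simp add: power2_eq_square field_simps)
    finally show "\<bar>1 / (t - x k) - 1 / (s - x k)\<bar> \<le> 2 * real N / \<delta> * (1 / (real_of_int k)\<^sup>2)" .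
  qed
  also have "\<dots> = 2 * real N / \<delta> * (\<Sum>k\<in>F. 1 / (real_of_int k)\<^sup>2)" by (rule sum_distrib_left[symmetric])
  also have "\<dots> \<le> 2 * real N / \<delta> * (2 / real N)"
    using assms(1,5,6) \<delta>_pos by (intro mult_left_mono sum_inverse_square_tail_le) auto
  also have "\<dots> = 4 / \<delta>" using assms(1) by simp
  finally show ?thesis .
qed

end

section \<open>Averages of the interpolation\<close>

lemma ennreal_scaled_integral_le:
  assumes "r > 0" "AE t in lborel. t \<in> {-r..r} \<longrightarrow> h t \<le> ennreal m" "m \<ge> 0"
  shows "ennreal (1 / (2 * r)) * (\<integral>\<^sup>+ t\<in>{-r..r}. h t \<partial>lborel) \<le> ennreal m"
proof -
  have "(\<integral>\<^sup>+ t\<in>{-r..r}. h t \<partial>lborel) \<le> (\<integral>\<^sup>+ t. ennreal m * indicator {-r..r} t \<partial>lborel)"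
    using assms(2) by (intro nn_integral_mono_AE) (auto elim!: eventually_mono split: split_indicator)
  also have "\<dots> = ennreal m * ennreal (2 * r)"
    using assms(1) by (subst nn_integral_cmult_indicator) auto
  finally have "ennreal (1 / (2 * r)) * (\<integral>\<^sup>+ t\<in>{-r..r}. h t \<partial>lborel)
      \<le> ennreal (1 / (2 * r)) * (ennreal m * ennreal (2 * r))"
    by (intro mult_left_mono) auto
  also have "\<dots> = ennreal (1 / (2 * r) * (m * (2 * r)))"
  proof -
    have "ennreal m * ennreal (2 * r) = ennreal (m * (2 * r))"
      using assms(1,3) by (intro ennreal_mult[symmetric]) auto
    moreover have "ennreal (1 / (2 * r)) * ennreal (m * (2 * r)) = ennreal (1 / (2 * r) * (m * (2 * r)))"
      using assms(1,3) by (intro ennreal_mult[symmetric]) auto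
    ultimately show ?thesis by (simp only:)
  qed
  also have "1 / (2 * r) * (m * (2 * r)) = m" using assms by simp
  finally show ?thesis .
qed

text \<open>The assumptions collect what \<open>sine_type_bounds\<close> says about the generating function of a
  separated sequence; the averages are estimated from these facts alone.\<close>
locale interpolation_setting = separated_seq +
  fixes xt B c :: real
  assumes B_pos: "B > 0" and c_pos: "c > 0"
    and S_le: "cmod (gen_fun x (complex_of_real t)) \<le> B"
    and S_le_dist: "cmod (gen_fun x (complex_of_real t)) \<le> B * \<bar>t - x k\<bar>"
    and deriv_ge: "c \<le> cmod (deriv (gen_fun x) (complex_of_real (x k)))"
    and S_entire: "gen_fun x holomorphic_on UNIV"
begin

abbreviation S :: "real \<Rightarrow> complex" where
  "S t \<equiv> gen_fun x (complex_of_real t)"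

definition node_coeff :: "(int \<Rightarrow> real) \<Rightarrow> int \<Rightarrow> complex" where
  "node_coeff a k = complex_of_real (a k) / deriv (gen_fun x) (complex_of_real (x k))"

text \<open>The terms \<open>1 / (xt - x k)\<close> in the interpolation series make it converge. For \<open>\<bar>k\<bar> \<le> N\<close> they are
  split off into this sum, which does not depend on the point of evaluation.\<close>
definition anchor_sum :: "(int \<Rightarrow> real) \<Rightarrow> nat \<Rightarrow> complex" where
  "anchor_sum a N = (\<Sum>k\<in>{- int N..int N}. node_coeff a k / complex_of_real (xt - x k))"

abbreviation interp :: "(int \<Rightarrow> real) \<Rightarrow> real \<Rightarrow> real \<Rightarrow> complex" where
  "interp a a0 t \<equiv> bandlimited_interp x xt (\<lambda>k. complex_of_real (a k)) (complex_of_real a0) (complex_of_real t)"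

lemma norm_node_coeff_le:
  assumes "\<bar>a k\<bar> \<le> \<alpha>"
  shows "cmod (node_coeff a k) \<le> \<alpha> / c"
  unfolding node_coeff_def norm_divide using assms deriv_ge[of k] c_pos
  by (intro frac_le) auto

text \<open>The limits in the definition give the summands their values at the nodes; elsewhere each
  summand is continuous and its limit is its value.\<close>
lemma interp_off_nodes:
  assumes "t \<notin> range x"
  shows "interp a a0 t = complex_of_real a0 * S t / S xt
     + S t * (\<Sum>\<^sub>\<infinity>k. node_coeff a k * complex_of_real (1 / (t - x k) - 1 / (xt - x k)))"
proof -
  have "complex_of_real (a k) * Lim (at (complex_of_real t)) (\<lambda>z0.
        gen_fun x z0 / deriv (gen_fun x) (of_real (x k)) *
        (1 / (z0 - of_real (x k)) - 1 / (of_real xt - of_real (x k))))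
     = S t * (node_coeff a k * complex_of_real (1 / (t - x k) - 1 / (xt - x k)))" for k
  proof -
    let ?g = "\<lambda>z0. gen_fun x z0 / deriv (gen_fun x) (of_real (x k)) *
        (1 / (z0 - of_real (x k)) - 1 / (of_real xt - of_real (x k)))"
    have nz: "complex_of_real t - complex_of_real (x k) \<noteq> 0" using assms by auto
    have d: "deriv (gen_fun x) (of_real (x k)) \<noteq> 0" using deriv_ge[of k] c_pos by auto
    have "isCont (gen_fun x) (complex_of_real t)"
      using holomorphic_on_imp_continuous_on[OF S_entire] by (simp add: continuous_on_eq_continuous_at)
    then have "isCont ?g (complex_of_real t)"
      using nz d by (intro continuous_intros) auto
    then have "Lim (at (complex_of_real t)) ?g = ?g (complex_of_real t)"
      by (intro tendsto_Lim) (auto simp: isCont_def)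
    then show ?thesis by (simp add: node_coeff_def)
  qed
  then show ?thesis
    unfolding bandlimited_interp_def by (simp only: infsum_cmult_right')
qed

text \<open>The series is split at \<open>\<bar>k\<bar> = N\<close>, where \<open>\<bar>t\<bar>\<close> is at most \<open>\<delta> N / 4\<close>. The far terms are bounded by
  \<open>far_nodes_sum_le\<close>; each near term falls into its Cauchy part, controlled by the lattice
  transform, and its anchor part.\<close>
lemma norm_interp_le:
  assumes N: "N > 0" "4 * \<bar>x 0\<bar> \<le> \<delta> * real N" "\<bar>xt\<bar> \<le> \<delta> * real N / 4" "\<bar>t\<bar> \<le> \<delta> * real N / 4"
    and a: "\<And>k. \<bar>a k\<bar> \<le> \<alpha>" "\<bar>a0\<bar> \<le> \<alpha>" and t: "t \<notin> range x"
  shows "cmod (interp a a0 t) \<le> \<alpha> * B / cmod (S xt) + 4 * \<alpha> * B / (c * \<delta>) + 5 * (\<alpha> / c) * B * (2 + 4 / \<delta>)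
      + B * cmod (anchor_sum a N) + B / \<delta> * cmod (lattice_transform {- int N..int N} (node_coeff a) \<lfloor>t / \<delta>\<rfloor>)"
proof -
  let ?D = "{- int N..int N}"
  let ?f = "\<lambda>k. node_coeff a k * complex_of_real (1 / (t - x k) - 1 / (xt - x k))"
  have \<alpha>: "\<alpha> \<ge> 0" using a(2) by auto
  have coeff: "cmod (node_coeff a k) \<le> \<alpha> / c" for k using a(1) by (rule norm_node_coeff_le)
  have bound: "(\<Sum>k\<in>F. norm (?f k)) \<le> \<alpha> / c * (4 / \<delta>)" if F: "finite F" "F \<subseteq> - ?D" for F
  proof -
    have "(\<Sum>k\<in>F. norm (?f k)) \<le> (\<Sum>k\<in>F. \<alpha> / c * \<bar>1 / (t - x k) - 1 / (xt - x k)\<bar>)"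
      unfolding norm_mult norm_of_real using coeff by (intro sum_mono mult_right_mono) auto
    also have "\<dots> = \<alpha> / c * (\<Sum>k\<in>F. \<bar>1 / (t - x k) - 1 / (xt - x k)\<bar>)" by (rule sum_distrib_left[symmetric])
    also have "\<dots> \<le> \<alpha> / c * (4 / \<delta>)"
    proof -
      have "\<bar>k\<bar> > int N" if "k \<in> F" for k using F(2) that by force
      then show ?thesis using N F \<alpha> c_pos by (intro mult_left_mono far_nodes_sum_le) auto
    qed
    finally show ?thesis .
  qed
  have abs: "(\<lambda>k. norm (?f k)) summable_on - ?D"
    using bound by (intro nonneg_bdd_above_summable_on) (auto intro!: bdd_aboveI)
  have far: "cmod (\<Sum>\<^sub>\<infinity>k\<in>- ?D. ?f k) \<le> \<alpha> / c * (4 / \<delta>)"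
  proof -
    have "cmod (\<Sum>\<^sub>\<infinity>k\<in>- ?D. ?f k) \<le> (\<Sum>\<^sub>\<infinity>k\<in>- ?D. cmod (?f k))"
      by (rule norm_infsum_bound[OF abs])
    also have "\<dots> \<le> \<alpha> / c * (4 / \<delta>)"
      using abs bound by (intro infsum_le_finite_sums) auto
    finally show ?thesis .
  qed
  have "(\<Sum>\<^sub>\<infinity>k. ?f k) = (\<Sum>\<^sub>\<infinity>k\<in>?D \<union> - ?D. ?f k)" by simp
  also have "\<dots> = (\<Sum>\<^sub>\<infinity>k\<in>?D. ?f k) + (\<Sum>\<^sub>\<infinity>k\<in>- ?D. ?f k)"
    by (rule infsum_Un_disjoint[OF summable_on_finite abs_summable_summable[OF abs]]) auto
  also have "(\<Sum>\<^sub>\<infinity>k\<in>?D. ?f k) = (\<Sum>k\<in>?D. node_coeff a k / complex_of_real (t - x k)) - anchor_sum a N"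
    unfolding anchor_sum_def
    by (simp add: sum_subtractf[symmetric] algebra_simps divide_inverse)
  finally have decomp: "interp a a0 t = complex_of_real a0 * S t / S xt
     + S t * ((\<Sum>k\<in>?D. node_coeff a k / complex_of_real (t - x k)) - anchor_sum a N + (\<Sum>\<^sub>\<infinity>k\<in>- ?D. ?f k))"
    by (simp add: interp_off_nodes[OF t])
  have tri: "cmod (u + s * (v - w + y)) \<le> cmod u + cmod s * cmod v + cmod s * cmod w + cmod s * cmod y"
    for u s v w y
  proof -
    have "cmod (u + s * (v - w + y)) \<le> cmod u + cmod s * cmod (v - w + y)"
      using norm_triangle_ineq[of u "s * (v - w + y)"] by (simp add: norm_mult)
    also have "cmod s * cmod (v - w + y) \<le> cmod s * (cmod v + cmod w + cmod y)"
      by (intro mult_left_mono order_trans[OF norm_triangle_ineq] add_right_mono norm_triangle_ineq4) auto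
    finally show ?thesis by (simp add: distrib_left)
  qed
  have 1: "cmod (complex_of_real a0 * S t / S xt) \<le> \<alpha> * B / cmod (S xt)"
    unfolding norm_mult norm_divide norm_of_real using a(2) \<alpha> S_le[of t]
    by (intro divide_right_mono mult_mono) auto
  have 2: "cmod (S t) * cmod (\<Sum>k\<in>?D. node_coeff a k / complex_of_real (t - x k))
      \<le> 5 * (\<alpha> / c) * B * (2 + 4 / \<delta>) + B / \<delta> * cmod (lattice_transform ?D (node_coeff a) \<lfloor>t / \<delta>\<rfloor>)"
    using coeff \<alpha> c_pos S_le S_le_dist t by (intro cauchy_sum_le_lattice_transform) auto
  have 3: "cmod (S t) * cmod (anchor_sum a N) \<le> B * cmod (anchor_sum a N)"
    using S_le[of t] by (intro mult_right_mono) auto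
  have 4: "cmod (S t) * cmod (\<Sum>\<^sub>\<infinity>k\<in>- ?D. ?f k) \<le> B * (\<alpha> / c * (4 / \<delta>))"
    using S_le[of t] far B_pos by (intro mult_mono) auto
  have 5: "B * (\<alpha> / c * (4 / \<delta>)) = 4 * \<alpha> * B / (c * \<delta>)" by simp
  show ?thesis
    unfolding decomp using tri[of "complex_of_real a0 * S t / S xt" "S t"] 1 2 3 4[unfolded 5]
    by (smt (verit, best))
qed

lemma AE_off_nodes: "AE t in lborel. t \<notin> range x"
  by (rule AE_not_in) (intro countable_imp_null_set_lborel countable_image countableI_type)

text \<open>On \<open>[-R n, R n]\<close> with \<open>R n = \<delta> 4^n / 4\<close> the series is split at \<open>N = 4^n\<close>, and the discrete
  Hilbert inequality bounds the mean square, hence the mean, of the lattice transform over the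
  \<open>2 N + 1\<close> relevant cells. A general radius loses at most a factor 4 against the next \<open>R n\<close>;
  radii below the first admissible \<open>R n\<close> are covered by a pointwise bound.\<close>
lemma interp_averages_bounded:
  assumes a: "\<And>k. \<bar>a k\<bar> \<le> \<alpha>" "\<bar>a0\<bar> \<le> \<alpha>"
    and Z: "\<And>n. n \<ge> n0 \<Longrightarrow> cmod (anchor_sum a (4 ^ n)) \<le> Zb"
  shows "(SUP r\<in>{0<..}. ennreal (1 / (2 * r)) *
       (\<integral>\<^sup>+ t\<in>{-r..r}. ennreal (cmod (interp a a0 t)) \<partial>lborel)) < \<infinity>"
proof -
  have \<alpha>: "\<alpha> \<ge> 0" using a(2) by auto
  have Zb: "Zb \<ge> 0" using Z[of n0] norm_ge_zero order_trans by blast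
  obtain n1 where n1: "n1 \<ge> n0" "4 * \<bar>x 0\<bar> \<le> \<delta> * 4 ^ n1" "4 * \<bar>xt\<bar> \<le> \<delta> * 4 ^ n1"
  proof -
    obtain m where m: "4 * (\<bar>x 0\<bar> + \<bar>xt\<bar>) / \<delta> < 4 ^ m" using real_arch_pow[of 4] by auto
    have "(4::real) ^ m \<le> 4 ^ max m n0" by (intro power_increasing) auto
    then have "4 * (\<bar>x 0\<bar> + \<bar>xt\<bar>) / \<delta> < 4 ^ max m n0" using m by linarith
    then have "4 * (\<bar>x 0\<bar> + \<bar>xt\<bar>) < \<delta> * 4 ^ max m n0"
      using \<delta>_pos by (simp add: pos_divide_less_eq mult.commute)
    then show thesis by (intro that[of "max m n0"]) auto
  qed
  define R where "R n = \<delta> * 4 ^ n / 4" for n :: nat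
  define G where "G = \<alpha> * B / cmod (S xt) + 4 * \<alpha> * B / (c * \<delta>) + 5 * (\<alpha> / c) * B * (2 + 4 / \<delta>) + B * Zb"
  define H where "H n j = cmod (lattice_transform {- int (4 ^ n)..int (4 ^ n)} (node_coeff a) j)" for n :: nat and j
  have G: "G \<ge> 0" using \<alpha> B_pos c_pos \<delta>_pos Zb by (simp add: G_def)
  have H0: "H n j \<ge> 0" for n j by (simp add: H_def)
  have R_pos: "R n > 0" for n using \<delta>_pos by (simp add: R_def)
  have pointwise: "cmod (interp a a0 t) \<le> G + B / \<delta> * H n \<lfloor>t / \<delta>\<rfloor>"
    if n: "n \<ge> n1" and t: "\<bar>t\<bar> \<le> R n" "t \<notin> range x" for n t
  proof -
    have "(4::real) ^ n1 \<le> 4 ^ n" using n by (intro power_increasing) auto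
    then have "\<delta> * 4 ^ n1 \<le> \<delta> * 4 ^ n" using \<delta>_pos by simp
    then have "4 * \<bar>x 0\<bar> \<le> \<delta> * real (4 ^ n)" "\<bar>xt\<bar> \<le> \<delta> * real (4 ^ n) / 4" using n1 by auto
    moreover have "\<bar>t\<bar> \<le> \<delta> * real (4 ^ n) / 4" using t by (simp add: R_def)
    moreover have "(4::nat) ^ n > 0" by simp
    ultimately have "cmod (interp a a0 t) \<le> \<alpha> * B / cmod (S xt) + 4 * \<alpha> * B / (c * \<delta>) + 5 * (\<alpha> / c) * B * (2 + 4 / \<delta>)
      + B * cmod (anchor_sum a (4 ^ n)) + B / \<delta> * H n \<lfloor>t / \<delta>\<rfloor>"
      unfolding H_def using a t(2) by (intro norm_interp_le) blast+
    moreover have "B * cmod (anchor_sum a (4 ^ n)) \<le> B * Zb"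
      using Z[of n] n n1(1) B_pos by (intro mult_left_mono) auto
    ultimately show ?thesis by (simp add: G_def)
  qed
  define M where "M = G + B / \<delta> * (\<Sum>j\<in>{- int (4 ^ n1)..int (4 ^ n1)}. H n1 j)"
  define E where "E = 6 * (G + B / \<delta> * (1 + 50 * (\<alpha> / c)\<^sup>2))"
  have M: "M \<ge> 0" using G B_pos \<delta>_pos H0 by (simp add: M_def sum_nonneg)
  have E: "E \<ge> 0" using G B_pos \<delta>_pos by (simp add: E_def)
  have small: "ennreal (1 / (2 * r)) * (\<integral>\<^sup>+ t\<in>{-r..r}. ennreal (cmod (interp a a0 t)) \<partial>lborel) \<le> ennreal M"
    if r: "0 < r" "r \<le> R n1" for r
  proof (rule ennreal_scaled_integral_le[OF r(1) _ M])
    show "AE t in lborel. t \<in> {-r..r} \<longrightarrow> ennreal (cmod (interp a a0 t)) \<le> ennreal M"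
      using AE_off_nodes
    proof eventually_elim
      case (elim t)
      show ?case
      proof
        assume "t \<in> {-r..r}"
        then have t: "\<bar>t\<bar> \<le> R n1" using r by auto
        then have "\<bar>t\<bar> \<le> \<delta> * real (4 ^ n1)" using R_pos[of n1] by (simp add: R_def)
        then have "\<lfloor>t / \<delta>\<rfloor> \<in> {- int (4 ^ n1)..int (4 ^ n1)}" by (rule cell_index_bounded)
        then have "H n1 \<lfloor>t / \<delta>\<rfloor> \<le> (\<Sum>j\<in>{- int (4 ^ n1)..int (4 ^ n1)}. H n1 j)"
          using H0 by (intro member_le_sum) auto
        then have "G + B / \<delta> * H n1 \<lfloor>t / \<delta>\<rfloor> \<le> M"
          unfolding M_def using B_pos \<delta>_pos by (intro add_left_mono mult_left_mono) auto
        then show "ennreal (cmod (interp a a0 t)) \<le> ennreal M"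
          using pointwise[OF _ t elim] by (intro ennreal_leI) linarith
      qed
    qed
  qed
  have dyadic: "(\<integral>\<^sup>+ t\<in>{-R n..R n}. ennreal (cmod (interp a a0 t)) \<partial>lborel) \<le> ennreal (2 * R n * E)"
    if n: "n \<ge> n1" for n
  proof -
    let ?D = "{- int (4 ^ n)..int (4 ^ n)}"
    let ?g = "\<lambda>j. G + B / \<delta> * H n j"
    have g0: "?g j \<ge> 0" for j using G H0 B_pos \<delta>_pos by simp
    have card: "real (card ?D) = 2 * 4 ^ n + 1" by simp
    have card_le: "real (card ?D) \<le> 3 * 4 ^ n" unfolding card by simp
    have "(\<integral>\<^sup>+ t\<in>{-R n..R n}. ennreal (cmod (interp a a0 t)) \<partial>lborel)
        \<le> (\<integral>\<^sup>+ t\<in>{-R n..R n}. ennreal (?g \<lfloor>t / \<delta>\<rfloor>) \<partial>lborel)"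
    proof (rule nn_integral_mono_AE)
      show "AE t in lborel. ennreal (cmod (interp a a0 t)) * indicator {-R n..R n} t
          \<le> ennreal (?g \<lfloor>t / \<delta>\<rfloor>) * indicator {-R n..R n} t"
        using AE_off_nodes
      proof eventually_elim
        case (elim t)
        then show ?case using pointwise[OF n _ elim]
          by (auto split: split_indicator intro!: ennreal_leI)
      qed
    qed
    also have "\<dots> \<le> ennreal (\<delta> * (\<Sum>j\<in>?D. ?g j))"
      using g0 \<delta>_pos by (intro nn_integral_cells_le) (auto simp: R_def)
    also have "\<dots> \<le> ennreal (2 * R n * E)"
    proof (intro ennreal_leI)
      have H1: "H n j \<le> 1 + (H n j)\<^sup>2" for j
        using zero_le_power2[of "H n j - 1"] H0[of n j] by (simp add: power2_eq_square algebra_simps)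
      have "(\<Sum>j\<in>?D. H n j) \<le> (\<Sum>j\<in>?D. 1 + (H n j)\<^sup>2)" using H1 by (rule sum_mono)
      also have "\<dots> = real (card ?D) + (\<Sum>j\<in>?D. (H n j)\<^sup>2)" unfolding sum.distrib by simp
      also have "\<dots> \<le> real (card ?D) + 50 * (\<alpha> / c)\<^sup>2 * real (card ?D)"
        unfolding H_def using a(1)
        by (intro add_left_mono lattice_transform_square_sum_le norm_node_coeff_le) auto
      also have "\<dots> = (1 + 50 * (\<alpha> / c)\<^sup>2) * real (card ?D)" by (simp only: algebra_simps)
      finally have HH: "(\<Sum>j\<in>?D. H n j) \<le> (1 + 50 * (\<alpha> / c)\<^sup>2) * real (card ?D)" .
      have "(\<Sum>j\<in>?D. ?g j) = real (card ?D) * G + B / \<delta> * (\<Sum>j\<in>?D. H n j)"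
        unfolding sum.distrib sum_distrib_left by simp
      also have "\<dots> \<le> real (card ?D) * G + B / \<delta> * ((1 + 50 * (\<alpha> / c)\<^sup>2) * real (card ?D))"
        using HH B_pos \<delta>_pos by (intro add_left_mono mult_left_mono) auto
      also have "\<dots> = real (card ?D) * (G + B / \<delta> * (1 + 50 * (\<alpha> / c)\<^sup>2))"
      proof -
        have "p * G + q * (u * p) = p * (G + q * u)" for p q u :: real by (simp add: algebra_simps)
        then show ?thesis .
      qed
      also have "\<dots> = real (card ?D) * (E / 6)" by (simp add: E_def)
      also have "\<dots> \<le> 3 * 4 ^ n * (E / 6)" using card_le E by (intro mult_right_mono) auto
      finally have "\<delta> * (\<Sum>j\<in>?D. ?g j) \<le> \<delta> * (3 * 4 ^ n * (E / 6))"
        using \<delta>_pos by (intro mult_left_mono) auto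
      also have "\<dots> = 2 * R n * E" by (simp add: R_def)
      finally show "\<delta> * (\<Sum>j\<in>?D. ?g j) \<le> 2 * R n * E" .
    qed
    finally show ?thesis .
  qed
  have large: "ennreal (1 / (2 * r)) * (\<integral>\<^sup>+ t\<in>{-r..r}. ennreal (cmod (interp a a0 t)) \<partial>lborel) \<le> ennreal (4 * E)"
    if r: "r > R n1" for r
  proof -
    have "\<exists>n. r \<le> R n"
    proof -
      obtain m where "4 * r / \<delta> < 4 ^ m" using real_arch_pow[of 4] by auto
      then have "r \<le> R m" using \<delta>_pos by (simp add: R_def pos_divide_less_eq mult.commute)
      then show ?thesis by blast
    qed
    define n where "n = (LEAST n. r \<le> R n)"
    have n: "r \<le> R n" unfolding n_def by (rule LeastI_ex) fact
    have R_mono: "R i \<le> R j" if "i \<le> j" for i j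
      using that \<delta>_pos by (simp add: R_def)
    have "n > n1"
    proof (rule ccontr)
      assume "\<not> n > n1"
      then show False using R_mono[of n n1] n r by simp
    qed
    then obtain p where p: "n = Suc p" "p \<ge> n1" by (cases n) auto
    have "\<not> r \<le> R p" using not_less_Least[of p "\<lambda>n. r \<le> R n"] p(1) by (simp add: n_def[symmetric])
    then have rp: "R n < 4 * r" by (simp add: R_def p(1))
    have r0: "r > 0" using r R_pos[of n1] by simp
    have "(\<integral>\<^sup>+ t\<in>{-r..r}. ennreal (cmod (interp a a0 t)) \<partial>lborel)
        \<le> (\<integral>\<^sup>+ t\<in>{-R n..R n}. ennreal (cmod (interp a a0 t)) \<partial>lborel)"
      using n by (intro nn_integral_mono) (auto split: split_indicator)
    also have "\<dots> \<le> ennreal (2 * R n * E)" using p by (intro dyadic) auto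
    also have "\<dots> \<le> ennreal (2 * (4 * r) * E)"
      using rp E by (intro ennreal_leI mult_right_mono) auto
    finally have "ennreal (1 / (2 * r)) * (\<integral>\<^sup>+ t\<in>{-r..r}. ennreal (cmod (interp a a0 t)) \<partial>lborel)
        \<le> ennreal (1 / (2 * r)) * ennreal (2 * (4 * r) * E)"
      by (intro mult_left_mono) auto
    also have "\<dots> = ennreal (1 / (2 * r) * (2 * (4 * r) * E))"
      using r0 E by (intro ennreal_mult[symmetric]) auto
    also have "1 / (2 * r) * (2 * (4 * r) * E) = 4 * E" using r0 by simp
    finally show ?thesis .
  qed
  have "(SUP r\<in>{0<..}. ennreal (1 / (2 * r)) *
       (\<integral>\<^sup>+ t\<in>{-r..r}. ennreal (cmod (interp a a0 t)) \<partial>lborel)) \<le> ennreal (max M (4 * E))"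
  proof (rule SUP_least)
    fix r :: real assume r: "r \<in> {0<..}"
    show "ennreal (1 / (2 * r)) * (\<integral>\<^sup>+ t\<in>{-r..r}. ennreal (cmod (interp a a0 t)) \<partial>lborel)
        \<le> ennreal (max M (4 * E))"
    proof (cases "r \<le> R n1")
      case True
      then show ?thesis using r by (intro order_trans[OF small ennreal_leI]) auto
    next
      case False
      then show ?thesis by (intro order_trans[OF large ennreal_leI]) auto
    qed
  qed
  also have "\<dots> < \<infinity>" by simp
  finally show ?thesis .
qed

end

section \<open>Random partial sums\<close>

context prob_space
begin

text \<open>Orthogonality removes the mixed terms of the expanded square.\<close>
lemma second_moment_sum_le:
  fixes a :: "'i \<Rightarrow> 'a \<Rightarrow> real" and w :: "'i \<Rightarrow> 'b::real_inner"
  assumes "finite D"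
    and meas: "\<And>k. random_variable borel (a k)"
    and bd: "\<And>k. AE \<omega> in M. \<bar>a k \<omega>\<bar> \<le> \<alpha>"
    and orth: "\<And>j k. j \<noteq> k \<Longrightarrow> expectation (\<lambda>\<omega>. a j \<omega> * a k \<omega>) = 0"
  shows "(\<integral>\<^sup>+ \<omega>. ennreal ((norm (\<Sum>k\<in>D. a k \<omega> *\<^sub>R w k))\<^sup>2) \<partial>M) \<le> ennreal (\<alpha>\<^sup>2 * (\<Sum>k\<in>D. (norm (w k))\<^sup>2))"
proof -
  have bd2: "AE \<omega> in M. \<bar>a j \<omega> * a k \<omega>\<bar> \<le> \<alpha> * \<alpha>" for j k
    using bd[of j] bd[of k] by eventually_elim (auto simp: abs_mult intro!: mult_mono)
  have int: "integrable M (\<lambda>\<omega>. a j \<omega> * a k \<omega>)" for j k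
    using bd2[of j k] meas by (intro integrable_const_bound[where B = "\<alpha> * \<alpha>"]) auto
  have "(\<integral>\<^sup>+ \<omega>. ennreal ((norm (\<Sum>k\<in>D. a k \<omega> *\<^sub>R w k))\<^sup>2) \<partial>M)
      = ennreal (\<integral> \<omega>. (norm (\<Sum>k\<in>D. a k \<omega> *\<^sub>R w k))\<^sup>2 \<partial>M)"
  proof (rule nn_integral_eq_integral)
    show "integrable M (\<lambda>\<omega>. (norm (\<Sum>k\<in>D. a k \<omega> *\<^sub>R w k))\<^sup>2)"
      unfolding norm_sum_scaleR_square using int by (intro Bochner_Integration.integrable_sum integrable_mult_left)
  qed auto
  also have "(\<integral> \<omega>. (norm (\<Sum>k\<in>D. a k \<omega> *\<^sub>R w k))\<^sup>2 \<partial>M)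
      = (\<Sum>j\<in>D. \<Sum>k\<in>D. expectation (\<lambda>\<omega>. a j \<omega> * a k \<omega>) * inner (w j) (w k))"
    unfolding norm_sum_scaleR_square using int
    by (simp add: Bochner_Integration.integral_sum)
  also have "\<dots> = (\<Sum>j\<in>D. expectation (\<lambda>\<omega>. a j \<omega> * a j \<omega>) * (norm (w j))\<^sup>2)"
  proof (rule sum.cong[OF refl])
    fix j assume j: "j \<in> D"
    have "(\<Sum>k\<in>D. expectation (\<lambda>\<omega>. a j \<omega> * a k \<omega>) * inner (w j) (w k))
        = (\<Sum>k\<in>{j}. expectation (\<lambda>\<omega>. a j \<omega> * a k \<omega>) * inner (w j) (w k))"
      using j assms(1) orth by (intro sum.mono_neutral_right) auto
    then show "(\<Sum>k\<in>D. expectation (\<lambda>\<omega>. a j \<omega> * a k \<omega>) * inner (w j) (w k))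
        = expectation (\<lambda>\<omega>. a j \<omega> * a j \<omega>) * (norm (w j))\<^sup>2"
      by (simp add: power2_norm_eq_inner)
  qed
  also have "\<dots> \<le> (\<Sum>j\<in>D. \<alpha>\<^sup>2 * (norm (w j))\<^sup>2)"
  proof (intro sum_mono mult_right_mono)
    fix j
    have "expectation (\<lambda>\<omega>. a j \<omega> * a j \<omega>) \<le> expectation (\<lambda>\<omega>. \<alpha> * \<alpha>)"
      using int bd2[of j j] by (intro integral_mono_AE) auto
    then show "expectation (\<lambda>\<omega>. a j \<omega> * a j \<omega>) \<le> \<alpha>\<^sup>2"
      by (simp add: prob_space power2_eq_square)
  qed auto
  also have "\<dots> = \<alpha>\<^sup>2 * (\<Sum>j\<in>D. (norm (w j))\<^sup>2)" by (rule sum_distrib_left[symmetric])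
  finally show ?thesis by (simp add: ennreal_leI)
qed

text \<open>The increment of the partial sums from \<open>4^n\<close> to \<open>4^(n+1)\<close> has second moment \<open>O(4^-n)\<close>. Weighting
  by \<open>2^n\<close> leaves a convergent series of expectations, so almost surely the weighted squares are
  summable, and then so are the increments themselves, since \<open>y \<le> 2^-n + 2^n y\<^sup>2\<close>.\<close>
lemma AE_bounded_random_partial_sums:
  fixes a :: "int \<Rightarrow> 'a \<Rightarrow> real" and w :: "int \<Rightarrow> complex"
  assumes meas: "\<And>k. random_variable borel (a k)"
    and bd: "\<And>k. AE \<omega> in M. \<bar>a k \<omega>\<bar> \<le> \<alpha>"
    and orth: "\<And>j k. j \<noteq> k \<Longrightarrow> expectation (\<lambda>\<omega>. a j \<omega> * a k \<omega>) = 0"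
    and w: "\<And>k. \<bar>k\<bar> > 4 ^ n0 \<Longrightarrow> cmod (w k) \<le> W / \<bar>real_of_int k\<bar>"
  shows "AE \<omega> in M. \<exists>Zb. \<forall>n\<ge>n0. cmod (\<Sum>k\<in>{- int (4 ^ n)..int (4 ^ n)}. a k \<omega> *\<^sub>R w k) \<le> Zb"
proof -
  define D where "D n = {k::int. 4 ^ (n0 + n) < \<bar>k\<bar> \<and> \<bar>k\<bar> \<le> 4 ^ (n0 + Suc n)}" for n
  have finD: "finite (D n)" for n
    unfolding D_def by (rule finite_subset[of _ "{- (4 ^ (n0 + Suc n))..4 ^ (n0 + Suc n)}"]) auto
  define Y where "Y n \<omega> = (\<Sum>k\<in>D n. a k \<omega> *\<^sub>R w k)" for n \<omega>
  define Z where "Z n \<omega> = (\<Sum>k\<in>{- int (4 ^ n)..int (4 ^ n)}. a k \<omega> *\<^sub>R w k)" for n \<omega>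
  have Z_Suc: "Z (n0 + Suc n) \<omega> = Z (n0 + n) \<omega> + Y n \<omega>" for n \<omega>
  proof -
    have "(4::int) ^ (n0 + n) \<le> 4 ^ (n0 + Suc n)" by (intro power_increasing) auto
    then have "{- int (4 ^ (n0 + Suc n))..int (4 ^ (n0 + Suc n))}
        = {- int (4 ^ (n0 + n))..int (4 ^ (n0 + n))} \<union> D n"
      unfolding D_def of_nat_power of_nat_numeral by (auto simp: abs_if split: if_splits)
    then show ?thesis
      unfolding Z_def Y_def using finD
      by (simp only:) (rule sum.union_disjoint, auto simp: D_def)
  qed
  have moment: "(\<integral>\<^sup>+ \<omega>. ennreal (2 ^ n * (cmod (Y n \<omega>))\<^sup>2) \<partial>M) \<le> ennreal (2 * \<alpha>\<^sup>2 * W\<^sup>2 * (1 / 2) ^ n)" for n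
  proof -
    have "(\<Sum>k\<in>D n. (cmod (w k))\<^sup>2) \<le> (\<Sum>k\<in>D n. W\<^sup>2 * (1 / (real_of_int k)\<^sup>2))"
    proof (rule sum_mono)
      fix k assume "k \<in> D n"
      then have "4 ^ (n0 + n) < \<bar>k\<bar>" by (simp add: D_def)
      moreover have "(4::int) ^ n0 \<le> 4 ^ (n0 + n)" by (intro power_increasing) auto
      ultimately have "\<bar>k\<bar> > 4 ^ n0" by (rule le_less_trans[rotated])
      from w[OF this] have "(cmod (w k))\<^sup>2 \<le> (W / \<bar>real_of_int k\<bar>)\<^sup>2" by (intro power_mono) auto
      then show "(cmod (w k))\<^sup>2 \<le> W\<^sup>2 * (1 / (real_of_int k)\<^sup>2)" by (simp add: power_divide)
    qed
    also have "\<dots> = W\<^sup>2 * (\<Sum>k\<in>D n. 1 / (real_of_int k)\<^sup>2)" by (rule sum_distrib_left[symmetric])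
    also have "\<dots> \<le> W\<^sup>2 * (2 / real (4 ^ (n0 + n)))"
      using finD by (intro mult_left_mono sum_inverse_square_tail_le) (auto simp: D_def)
    also have "\<dots> \<le> W\<^sup>2 * (2 / 4 ^ n)"
    proof -
      have "(4::real) ^ n \<le> 4 ^ (n0 + n)" by (intro power_increasing) auto
      then show ?thesis by (intro mult_left_mono divide_left_mono) auto
    qed
    finally have sq: "(\<Sum>k\<in>D n. (cmod (w k))\<^sup>2) \<le> W\<^sup>2 * (2 / 4 ^ n)" .
    have "(\<integral>\<^sup>+ \<omega>. ennreal (2 ^ n * (cmod (Y n \<omega>))\<^sup>2) \<partial>M)
        = ennreal (2 ^ n) * (\<integral>\<^sup>+ \<omega>. ennreal ((cmod (Y n \<omega>))\<^sup>2) \<partial>M)"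
      using meas by (subst nn_integral_cmult[symmetric]) (auto simp: Y_def ennreal_mult)
    also have "\<dots> \<le> ennreal (2 ^ n) * ennreal (\<alpha>\<^sup>2 * (\<Sum>k\<in>D n. (cmod (w k))\<^sup>2))"
      unfolding Y_def using second_moment_sum_le[OF finD meas bd orth] by (intro mult_left_mono) auto
    also have "\<dots> = ennreal (2 ^ n * (\<alpha>\<^sup>2 * (\<Sum>k\<in>D n. (cmod (w k))\<^sup>2)))"
      by (intro ennreal_mult[symmetric]) (auto intro!: mult_nonneg_nonneg sum_nonneg)
    also have "\<dots> \<le> ennreal (2 ^ n * (\<alpha>\<^sup>2 * (W\<^sup>2 * (2 / 4 ^ n))))"
      using sq by (intro ennreal_leI mult_left_mono) auto
    also have "2 ^ n * (\<alpha>\<^sup>2 * (W\<^sup>2 * (2 / 4 ^ n))) = 2 * \<alpha>\<^sup>2 * W\<^sup>2 * (1 / 2) ^ n"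
    proof -
      have "(4::real) ^ n = 2 ^ n * 2 ^ n" by (simp flip: power_mult_distrib)
      then show ?thesis by (simp add: power_one_over field_simps)
    qed
    finally show ?thesis .
  qed
  have "(\<integral>\<^sup>+ \<omega>. (\<Sum>n. ennreal (2 ^ n * (cmod (Y n \<omega>))\<^sup>2)) \<partial>M)
      = (\<Sum>n. \<integral>\<^sup>+ \<omega>. ennreal (2 ^ n * (cmod (Y n \<omega>))\<^sup>2) \<partial>M)"
    using meas by (intro nn_integral_suminf) (auto simp: Y_def)
  also have "\<dots> \<le> (\<Sum>n. ennreal (2 * \<alpha>\<^sup>2 * W\<^sup>2 * (1 / 2) ^ n))"
    using moment by (intro suminf_le) auto
  also have "\<dots> < \<infinity>"
  proof -
    have "(\<lambda>n. 2 * \<alpha>\<^sup>2 * W\<^sup>2 * (1 / 2) ^ n) sums (2 * \<alpha>\<^sup>2 * W\<^sup>2 * (1 / (1 - 1 / 2)))"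
      by (intro sums_mult geometric_sums) auto
    then have "(\<Sum>n. ennreal (2 * \<alpha>\<^sup>2 * W\<^sup>2 * (1 / 2) ^ n)) = ennreal (2 * \<alpha>\<^sup>2 * W\<^sup>2 * (1 / (1 - 1 / 2)))"
      by (intro suminf_ennreal_eq) auto
    then show ?thesis by (simp only: ennreal_less_top infinity_ennreal_def)
  qed
  finally have "AE \<omega> in M. (\<Sum>n. ennreal (2 ^ n * (cmod (Y n \<omega>))\<^sup>2)) \<noteq> \<infinity>"
    using meas by (intro nn_integral_noteq_infinite) (auto simp: Y_def)
  then show ?thesis
  proof eventually_elim
    case (elim \<omega>)
    have s1: "summable (\<lambda>n. 2 ^ n * (cmod (Y n \<omega>))\<^sup>2)"
      using elim by (intro summable_suminf_not_top) auto
    have s2: "summable (\<lambda>n. (1 / 2) ^ n + 2 ^ n * (cmod (Y n \<omega>))\<^sup>2)"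
      using s1 by (intro summable_add summable_geometric) auto
    have le: "cmod (Y n \<omega>) \<le> (1 / 2) ^ n + 2 ^ n * (cmod (Y n \<omega>))\<^sup>2" for n
    proof (cases "cmod (Y n \<omega>) \<le> (1 / 2) ^ n")
      case False
      then have "1 \<le> 2 ^ n * cmod (Y n \<omega>)" by (simp add: power_one_over field_simps)
      then have "1 * cmod (Y n \<omega>) \<le> (2 ^ n * cmod (Y n \<omega>)) * cmod (Y n \<omega>)" by (intro mult_right_mono) auto
      then show ?thesis by (simp add: power2_eq_square mult_ac add_increasing)
    qed (simp add: add_increasing2)
    have s3: "summable (\<lambda>n. cmod (Y n \<omega>))"
      using le by (intro summable_comparison_test'[OF s2]) auto
    have "cmod (Z (n0 + m) \<omega>) \<le> cmod (Z n0 \<omega>) + (\<Sum>i<m. cmod (Y i \<omega>))" for m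
    proof (induction m)
      case (Suc m)
      have "cmod (Z (n0 + Suc m) \<omega>) \<le> cmod (Z (n0 + m) \<omega>) + cmod (Y m \<omega>)"
        unfolding Z_Suc by (rule norm_triangle_ineq)
      then show ?case using Suc by simp
    qed simp
    also have "(\<Sum>i<m. cmod (Y i \<omega>)) \<le> (\<Sum>i. cmod (Y i \<omega>))" for m
      using s3 by (intro sum_le_suminf) auto
    finally have "cmod (Z (n0 + m) \<omega>) \<le> cmod (Z n0 \<omega>) + (\<Sum>i. cmod (Y i \<omega>))" for m by simp
    then have "\<forall>n\<ge>n0. cmod (Z n \<omega>) \<le> cmod (Z n0 \<omega>) + (\<Sum>i. cmod (Y i \<omega>))"
      by (metis le_add_diff_inverse)
    then show ?case unfolding Z_def by blast
  qed
qed

lemma symmetric_uniform_facts: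
  fixes X :: "'a \<Rightarrow> real"
  assumes "\<alpha> > 0" and X: "random_variable borel X"
    and D: "distr M borel X = uniform_measure lborel {-\<alpha>..\<alpha>}"
  shows "AE \<omega> in M. \<bar>X \<omega>\<bar> \<le> \<alpha>" and "expectation X = 0"
proof -
  have "AE t in uniform_measure lborel {-\<alpha>..\<alpha>}. \<bar>t\<bar> \<le> \<alpha>"
    using assms(1) by (intro AE_uniform_measureI) auto
  then show "AE \<omega> in M. \<bar>X \<omega>\<bar> \<le> \<alpha>"
    unfolding D[symmetric] using X by (subst (asm) AE_distr_iff) auto
  have "distr M lborel X = distr M borel X" by (intro distr_cong) auto
  also have "\<dots> = density lborel (\<lambda>t. ennreal (indicator {-\<alpha>..\<alpha>} t / measure lborel {-\<alpha>..\<alpha>}))"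
    unfolding D uniform_measure_def using assms(1)
    by (intro density_cong) (auto simp: divide_ennreal[symmetric] ennreal_indicator)
  finally have "distributed M lborel X (\<lambda>t. indicator {-\<alpha>..\<alpha>} t / measure lborel {-\<alpha>..\<alpha>})"
    using X by (simp add: distributed_def)
  from uniform_distributed_expectation[OF this] show "expectation X = 0" by simp
qed

end

theorem theorem2:
  fixes M :: "'w measure"
    and b \<alpha> xt :: real
    and x :: "int \<Rightarrow> real"
    and a :: "int \<Rightarrow> 'w \<Rightarrow> real"
    and a0 :: "'w \<Rightarrow> real"
  assumes "prob_space M"
    and "b > 0" and "\<alpha> > 0"
    and "strict_mono x" and "separated x"
    and "sine_type x"
    and "exp_type (gen_fun x) \<le> ereal (pi * b)"
    and "xt \<notin> range x"
    and "prob_space.indep_vars M (\<lambda>_. borel) (case_option a0 a) (UNIV :: int option set)"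
    and "\<And>k. distr M borel (a k) = uniform_measure lborel {-\<alpha>..\<alpha>}"
    and "distr M borel a0 = uniform_measure lborel {-\<alpha>..\<alpha>}"
  shows "AE \<omega> in M.
    (SUP r\<in>{0<..}. ennreal (1 / (2 * r)) *
       (\<integral>\<^sup>+ t\<in>{-r..r}. ennreal (cmod (bandlimited_interp x xt
            (\<lambda>k. of_real (a k \<omega>)) (of_real (a0 \<omega>)) (of_real t))) \<partial>lborel)) < \<infinity>"
proof -
  interpret prob_space M by fact
  define \<delta> where "\<delta> = (INF k. \<bar>x (k + 1) - x k\<bar>)"
  interpret separated_seq x \<delta>
  proof
    show "\<delta> > 0" using assms(5) by (simp add: separated_def \<delta>_def)
    show "\<delta> \<le> x (k + 1) - x k" for k
    proof -
      have "\<delta> \<le> \<bar>x (k + 1) - x k\<bar>"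
        unfolding \<delta>_def by (intro cINF_lower bdd_belowI[of _ 0]) auto
      then show ?thesis using strict_monoD[OF assms(4), of k "k + 1"] by simp
    qed
  qed
  obtain B c where "B > 0" "c > 0"
    "\<And>t. cmod (gen_fun x (complex_of_real t)) \<le> B"
    "\<And>t k. cmod (gen_fun x (complex_of_real t)) \<le> B * \<bar>t - x k\<bar>"
    "\<And>k. c \<le> cmod (deriv (gen_fun x) (complex_of_real (x k)))"
    "gen_fun x holomorphic_on UNIV"
    using sine_type_bounds[OF separated_seq_axioms assms(6)] by blast
  then interpret interpolation_setting x \<delta> xt B c by unfold_locales
  have rv: "random_variable borel (case_option a0 a i)" for i
  proof -
    have "\<forall>i\<in>UNIV. random_variable borel (case_option a0 a i)"
      using assms(9) unfolding indep_vars_def by (rule conjunct1)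
    then show ?thesis by (rule bspec) simp
  qed
  have a_rv: "random_variable borel (a k)" for k using rv[of "Some k"] by simp
  have a0_rv: "random_variable borel a0" using rv[of None] by simp
  note a_facts = symmetric_uniform_facts[OF assms(3) a_rv assms(10)]
  have a_orth: "expectation (\<lambda>\<omega>. a j \<omega> * a k \<omega>) = 0" if "j \<noteq> k" for j k
  proof -
    have int: "integrable M (a i)" for i
      using a_facts(1)[of i] a_rv by (intro integrable_const_bound[where B = \<alpha>]) auto
    have "indep_vars (\<lambda>_. borel) (case_option a0 a) {Some j, Some k}"
      using assms(9) by (rule indep_vars_subset) auto
    then have "expectation (\<lambda>\<omega>. \<Prod>i\<in>{Some j, Some k}. case_option a0 a i \<omega>)
        = (\<Prod>i\<in>{Some j, Some k}. expectation (case_option a0 a i))"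
      using int by (intro indep_vars_lebesgue_integral) auto
    then show ?thesis using that a_facts(2) by simp
  qed
  obtain n0 where n0: "4 * (\<bar>x 0\<bar> + \<bar>xt\<bar>) < \<delta> * 4 ^ n0"
  proof -
    obtain m where "4 * (\<bar>x 0\<bar> + \<bar>xt\<bar>) / \<delta> < 4 ^ m" using real_arch_pow[of 4] by auto
    then show thesis using \<delta>_pos by (intro that[of m]) (simp add: pos_divide_less_eq mult.commute)
  qed
  define w where "w k = 1 / (deriv (gen_fun x) (complex_of_real (x k)) * complex_of_real (xt - x k))" for k
  have w: "cmod (w k) \<le> (2 / (c * \<delta>)) / \<bar>real_of_int k\<bar>" if k: "\<bar>k\<bar> > 4 ^ n0" for k
  proof -
    have "real_of_int \<bar>k\<bar> > real_of_int (4 ^ n0)" using k by (simp only: of_int_less_iff)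
    then have kn: "\<bar>real_of_int k\<bar> > 4 ^ n0" by simp
    have "(0::real) < 4 ^ n0" by simp
    then have k0: "\<bar>real_of_int k\<bar> > 0" using kn by (rule less_trans)
    have "\<delta> * 4 ^ n0 \<le> \<delta> * \<bar>real_of_int k\<bar>" using kn \<delta>_pos by simp
    with n0 have "4 * (\<bar>x 0\<bar> + \<bar>xt\<bar>) < \<delta> * \<bar>real_of_int k\<bar>" by (rule less_le_trans)
    moreover have "\<bar>x k\<bar> - \<bar>xt\<bar> \<le> \<bar>xt - x k\<bar>"
      using abs_triangle_ineq2[of "x k" xt] by (simp only: abs_minus_commute)
    moreover have "0 \<le> \<bar>x 0\<bar>" "0 \<le> \<bar>xt\<bar>" by simp_all
    ultimately have "\<delta> * \<bar>real_of_int k\<bar> / 2 \<le> \<bar>xt - x k\<bar>"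
      using abs_ge[of k] by argo
    then have "c * (\<delta> * \<bar>real_of_int k\<bar> / 2) \<le> cmod (deriv (gen_fun x) (complex_of_real (x k)) * complex_of_real (xt - x k))"
      unfolding norm_mult norm_of_real using deriv_ge[of k] c_pos \<delta>_pos by (intro mult_mono) auto
    moreover have "c * (\<delta> * \<bar>real_of_int k\<bar> / 2) > 0" using c_pos \<delta>_pos k0 by simp
    ultimately have "cmod (w k) \<le> 1 / (c * (\<delta> * \<bar>real_of_int k\<bar> / 2))"
      unfolding w_def norm_divide norm_one by (intro frac_le) auto
    then show ?thesis by (simp add: mult_ac)
  qed
  have anchor: "anchor_sum (\<lambda>k. a k \<omega>) N = (\<Sum>k\<in>{- int N..int N}. a k \<omega> *\<^sub>R w k)" for \<omega> N
    unfolding anchor_sum_def node_coeff_def w_def by (simp add: scaleR_conv_of_real)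
  have "AE \<omega> in M. \<exists>Zb. \<forall>n\<ge>n0. cmod (anchor_sum (\<lambda>k. a k \<omega>) (4 ^ n)) \<le> Zb"
    unfolding anchor using a_rv a_facts(1) a_orth w by (rule AE_bounded_random_partial_sums)
  moreover have "AE \<omega> in M. \<forall>k. \<bar>a k \<omega>\<bar> \<le> \<alpha>" using a_facts(1) by (simp add: AE_all_countable)
  moreover have "AE \<omega> in M. \<bar>a0 \<omega>\<bar> \<le> \<alpha>"
    using symmetric_uniform_facts(1)[OF assms(3) a0_rv assms(11)] .
  ultimately show ?thesis
  proof eventually_elim
    case (elim \<omega>)
    from elim(1) obtain Zb where "\<forall>n\<ge>n0. cmod (anchor_sum (\<lambda>k. a k \<omega>) (4 ^ n)) \<le> Zb" ..
    then have Zb: "cmod (anchor_sum (\<lambda>k. a k \<omega>) (4 ^ n)) \<le> Zb" if "n \<ge> n0" for n using that by simp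
    from elim(2) have "\<bar>a k \<omega>\<bar> \<le> \<alpha>" for k by simp
    from interp_averages_bounded[OF this elim(3) Zb] show ?case .
  qed
qed

end
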